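(* The class $\mathcal K$ of groups is closed under taking extensions with cyclic kernel: if $1\to A\to G\to H\to1$ is an exact sequence of groups with $A$ cyclic and $H\in\mathcal K$, then $G\in\mathcal K$.
   Context: $\mathcal K$ is the smallest class of (discrete) groups containing all free groups and all amenable groups and closed under taking extensions with amenable quotient (if $1\to N\to G\to Q\to1$ is exact with $N\in\mathcal K$ and $Q$ amenable, then $G\in\mathcal K$) and under taking directed unions. *)

theory Defs
  imports "HOL-Algebra.Algebra"
begin

section \<open>Free groups\<close>

text \<open>
  A word over \<open>S\<close> is a list of letters \<open>(x, b)\<close> with \<open>x \<in> S\<close>, where \<open>(x, True)\<close> stands for
  \<open>x\<close> and \<open>(x, False)\<close> for its formal inverse.  A group is free on \<open>S\<close> if each of its elements
  is the value of exactly one reduced word over \<open>S\<close>.  The basis may be empty or infinite.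
\<close>

definition reduced_words :: "'a set \<Rightarrow> ('a \<times> bool) list set" where
  "reduced_words S =
     {w. fst ` set w \<subseteq> S \<and> successively (\<lambda>(x, b) (y, c). \<not> (x = y \<and> b \<noteq> c)) w}"

definition word_value :: "'a monoid \<Rightarrow> ('a \<times> bool) list \<Rightarrow> 'a" where
  "word_value G w =
     foldr (\<lambda>(x, b) g. (if b then x else inv\<^bsub>G\<^esub> x) \<otimes>\<^bsub>G\<^esub> g) w \<one>\<^bsub>G\<^esub>"

definition free_group :: "'a monoid \<Rightarrow> bool" where
  "free_group G \<longleftrightarrow> group G \<and>
     (\<exists>S \<subseteq> carrier G. bij_betw (word_value G) (reduced_words S) (carrier G))"


section \<open>Amenable discrete groups\<close>

text \<open>
  Existence of a left-invariant finitely additive probability measure defined on all subsets of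
  the group.  Values of \<open>\<nu>\<close> outside \<open>Pow (carrier G)\<close> are irrelevant.
\<close>

definition amenable_group :: "'a monoid \<Rightarrow> bool" where
  "amenable_group G \<longleftrightarrow> group G \<and>
     (\<exists>\<nu> :: 'a set \<Rightarrow> real.
        (\<forall>E \<subseteq> carrier G. 0 \<le> \<nu> E) \<and>
        \<nu> (carrier G) = 1 \<and>
        (\<forall>E \<subseteq> carrier G. \<forall>F \<subseteq> carrier G. E \<inter> F = {} \<longrightarrow> \<nu> (E \<union> F) = \<nu> E + \<nu> F) \<and>
        (\<forall>g \<in> carrier G. \<forall>E \<subseteq> carrier G. \<nu> (g <#\<^bsub>G\<^esub> E) = \<nu> E))"


section \<open>The class \<open>\<K>\<close>\<close>

text \<open>
  HOL has no quantification over classes of groups living on different types, so closure under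
  extensions and directed unions is expressed with subgroups: an extension of \<open>Q\<close> by \<open>N\<close> is a
  group \<open>G\<close> with a normal subgroup (isomorphic to) \<open>N\<close> and quotient (isomorphic to) \<open>Q\<close>, and a
  directed union is a group covered by an upward directed family of subgroups.  Every rule only
  refers to subgroups of \<open>G\<close> and to an amenable quotient of \<open>G\<close>, and all notions involved are
  invariant under isomorphism, so membership of \<open>G\<close> does not depend on the type on which \<open>G\<close> is
  realised, and closure under isomorphism need not be a separate rule.
\<close>

inductive class_K :: "'a monoid \<Rightarrow> bool" where
  free: "free_group G \<Longrightarrow> class_K G"
| amenable: "amenable_group G \<Longrightarrow> class_K G"
| extension:
    "\<lbrakk>N \<lhd> G; class_K (G\<lparr>carrier := N\<rparr>); amenable_group (G Mod N)\<rbrakk> \<Longrightarrow> class_K G"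
| directed_union:
    "\<lbrakk>group G; \<F> \<noteq> {};
      \<forall>U \<in> \<F>. subgroup U G \<and> class_K (G\<lparr>carrier := U\<rparr>);
      \<forall>U \<in> \<F>. \<forall>V \<in> \<F>. \<exists>W \<in> \<F>. U \<subseteq> W \<and> V \<subseteq> W;
      carrier G = \<Union>\<F>\<rbrakk> \<Longrightarrow> class_K G"

end

theory Submission
  imports Defs "HOL-Analysis.Function_Topology"
begin

text \<open>
  Why the theorem holds.  The class \<open>\<K>\<close> is generated from free and amenable groups by two rules,
  and preimages under \<open>p : G \<rightarrow> H\<close> turn a derivation of \<open>H \<in> \<K>\<close> into one of \<open>G \<in> \<K>\<close>
  (\<open>class_K_cyclic_kernel\<close>).  The preimage of a subgroup of \<open>H\<close> has the same cyclic kernel \<open>A\<close> over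
  that subgroup, the quotient of \<open>G\<close> by the preimage of a normal subgroup \<open>N\<close> is \<open>H / N\<close>, and
  preimages preserve directed unions.  What remains are the two base cases.  If \<open>H\<close> is amenable,
  then \<open>G\<close> is an extension of the amenable group \<open>H\<close> by the amenable group \<open>A\<close>, so one use of the
  extension rule suffices.

  Let \<open>H = F\<close> be free (\<open>class_K_cyclic_by_free\<close>).  Lifting a basis of \<open>F\<close> to \<open>G\<close> gives a free
  subgroup \<open>E\<close> of \<open>G\<close> with \<open>p E = F\<close>, hence \<open>G = E A\<close>.  Let \<open>C\<close> be the centralizer of \<open>A\<close>.  It
  contains \<open>A\<close> because \<open>A\<close> is abelian, so \<open>C = L A\<close> for \<open>L = C \<inter> E\<close>.  Since \<open>A\<close> centralizes \<open>L\<close>, the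
  subgroup \<open>L\<close> is normal in \<open>C\<close>, and \<open>C / L\<close> is an image of \<open>A\<close>, thus cyclic and amenable.  As a
  subgroup of a free group, \<open>L\<close> is free.  Therefore \<open>C \<in> \<K>\<close>.  Finally, \<open>G / C\<close> embeds in the
  automorphism group of a cyclic group, so it is finite, hence amenable, and \<open>G \<in> \<K>\<close>.

  Two classical theorems carry this argument and are proved on the way.  The first is the
  Nielsen-Schreier theorem (\<open>nielsen_schreier\<close>): subgroups of free groups are free.  That
  Schreier's generators of a subgroup satisfy no relation is seen from an action of the free group on
  pairs of a group element and a reduced word over these generators: it recovers a reduced word from
  its value.  The second is the amenability of the integers (\<open>amenable_integer_group\<close>), where an
  invariant mean is found as a limit of the uniform measures on long intervals, by compactness of a
  product of unit intervals.
\<close>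

section \<open>Reduced words and the universal property of free groups\<close>

definition inv_letter :: "'a \<times> bool \<Rightarrow> 'a \<times> bool" where
  "inv_letter l = (fst l, \<not> snd l)"

definition letter_value :: "'a monoid \<Rightarrow> 'a \<times> bool \<Rightarrow> 'a" where
  "letter_value G l = (if snd l then fst l else inv\<^bsub>G\<^esub> fst l)"

text \<open>
  Multiplication of a reduced word by one letter from the left.  Folding it over an arbitrary word
  computes the reduced form, and for a fixed letter it permutes the reduced words.
\<close>

definition cancel_cons :: "'a \<times> bool \<Rightarrow> ('a \<times> bool) list \<Rightarrow> ('a \<times> bool) list" where
  "cancel_cons l w =
     (case w of [] \<Rightarrow> [l] | m # v \<Rightarrow> if m = inv_letter l then v else l # w)"

lemma inv_letter_inv_letter [simp]: "inv_letter (inv_letter l) = l"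
  by (simp add: inv_letter_def)

lemma inv_letter_in_iff [simp]: "inv_letter l \<in> S \<times> UNIV \<longleftrightarrow> l \<in> S \<times> UNIV"
  by (cases l) (simp add: inv_letter_def)

lemma reduced_words_eq:
  "reduced_words S = {w \<in> lists (S \<times> UNIV). successively (\<lambda>l m. m \<noteq> inv_letter l) w}"
proof -
  have "(\<lambda>(x, b) (y, c). \<not> (x = y \<and> b \<noteq> c)) = (\<lambda>l m :: 'a \<times> bool. m \<noteq> inv_letter l)"
    by (intro ext) (auto simp: inv_letter_def prod_eq_iff split: prod.splits)
  moreover have "fst ` set w \<subseteq> S \<longleftrightarrow> w \<in> lists (S \<times> UNIV)" for w :: "('a \<times> bool) list"
    by (auto simp: in_lists_conv_set mem_Times_iff)
  ultimately show ?thesis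
    unfolding reduced_words_def by simp
qed

lemma Nil_reduced [simp]: "[] \<in> reduced_words S"
  by (simp add: reduced_words_eq)

lemma reduced_words_lists: "w \<in> reduced_words T \<Longrightarrow> w \<in> lists (T \<times> UNIV)"
  by (simp add: reduced_words_eq)

lemma reduced_words_ConsD:
  "l # w \<in> reduced_words S \<Longrightarrow> l \<in> S \<times> UNIV \<and> w \<in> reduced_words S"
  by (auto simp: reduced_words_eq successively_Cons)

lemma cancel_cons_reduced:
  assumes "l \<in> S \<times> UNIV" "w \<in> reduced_words S"
  shows "cancel_cons l w \<in> reduced_words S"
  using assms by (cases w) (auto simp: cancel_cons_def reduced_words_eq successively_Cons)

lemma cancel_cons_inv_letter:
  assumes "w \<in> reduced_words S"
  shows "cancel_cons (inv_letter l) (cancel_cons l w) = w"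
proof (cases w)
  case (Cons m v)
  show ?thesis
  proof (cases "m = inv_letter l")
    case True
    then show ?thesis
      using assms Cons by (cases v) (auto simp: cancel_cons_def reduced_words_eq)
  qed (simp add: cancel_cons_def Cons)
qed (simp add: cancel_cons_def)

lemma cancel_cons_reduced_eq: "l # w \<in> reduced_words S \<Longrightarrow> cancel_cons l w = l # w"
  by (cases w) (auto simp: cancel_cons_def reduced_words_eq)

lemma foldr_cancel_cons_reduced:
  "w \<in> lists (S \<times> UNIV) \<Longrightarrow> v \<in> reduced_words S \<Longrightarrow> foldr cancel_cons w v \<in> reduced_words S"
  by (induction w) (auto intro: cancel_cons_reduced)

lemma foldr_cancel_cons_id: "w \<in> reduced_words S \<Longrightarrow> foldr cancel_cons w [] = w"
proof (induction w)
  case (Cons l w)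
  then show ?case
    using cancel_cons_reduced_eq[OF Cons.prems] reduced_words_ConsD[OF Cons.prems] by simp
qed simp

text \<open>
  The data that turns a set \<open>M\<close> into a set on which the free group over \<open>S\<close> acts, expressed on
  letters: one map for every letter, such that the maps of inverse letters undo each other.  A word
  acts by \<open>foldr\<close>, that is, with its last letter first, as in \<open>word_value\<close>.
\<close>

definition letter_action ::
  "'a set \<Rightarrow> 'x set \<Rightarrow> ('a \<times> bool \<Rightarrow> 'x \<Rightarrow> 'x) \<Rightarrow> bool" where
  "letter_action S M act \<longleftrightarrow>
     (\<forall>l \<in> S \<times> UNIV. \<forall>x \<in> M. act l x \<in> M \<and> act (inv_letter l) (act l x) = x)"

lemma letter_action_closed:
  assumes "letter_action S M act" "w \<in> lists (S \<times> UNIV)" "x \<in> M"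
  shows "foldr act w x \<in> M"
  using assms(2) by (induction w) (use assms in \<open>auto simp: letter_action_def\<close>)

lemma letter_action_inverse:
  assumes "letter_action S M act" "w \<in> lists (S \<times> UNIV)" "x \<in> M"
  shows "foldr act (rev (map inv_letter w)) (foldr act w x) = x"
  using assms(2)
proof (induction w)
  case (Cons l w)
  then have "foldr act w x \<in> M" by (intro letter_action_closed[OF assms(1)] assms) auto
  then show ?case using Cons assms(1) by (auto simp: letter_action_def)
qed simp

lemma letter_action_cancel_cons:
  assumes "letter_action S M act" "l \<in> S \<times> UNIV" "w \<in> lists (S \<times> UNIV)" "x \<in> M"
  shows "foldr act (cancel_cons l w) x = act l (foldr act w x)"
proof (cases w)
  case (Cons m v)
  then have "foldr act v x \<in> M"
    using assms by (intro letter_action_closed[OF assms(1)]) auto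
  then show ?thesis
    using assms(1,2) Cons inv_letter_in_iff[of l S] unfolding letter_action_def cancel_cons_def
    by (auto simp del: inv_letter_in_iff) (metis inv_letter_inv_letter)
qed (simp add: cancel_cons_def)

text \<open>
  Free reduction only deletes adjacent pairs of inverse letters, and these act as the identity.  The
  case of a group acting on itself by multiplication says that free reduction preserves values.
\<close>

lemma letter_action_normal_form:
  assumes "letter_action S M act" "w \<in> lists (S \<times> UNIV)" "x \<in> M"
  shows "foldr act (foldr cancel_cons w []) x = foldr act w x"
  using assms(2)
proof (induction w)
  case (Cons l w)
  then have "foldr cancel_cons w [] \<in> lists (S \<times> UNIV)"
    using foldr_cancel_cons_reduced[of w S "[]"] by (auto simp: reduced_words_eq)
  then show ?case
    using Cons by (simp add: letter_action_cancel_cons[OF assms(1) _ _ assms(3)])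
qed simp

lemma word_value_foldr:
  "word_value G w = foldr (\<lambda>l g. letter_value G l \<otimes>\<^bsub>G\<^esub> g) w \<one>\<^bsub>G\<^esub>"
  by (simp add: word_value_def letter_value_def case_prod_unfold)

lemma word_value_Nil [simp]: "word_value G [] = \<one>\<^bsub>G\<^esub>"
  by (simp add: word_value_foldr)

lemma word_value_Cons [simp]: "word_value G (l # w) = letter_value G l \<otimes>\<^bsub>G\<^esub> word_value G w"
  by (simp add: word_value_foldr)

text \<open>
  \<open>word_value\<close> is defined on plain monoid records, whereas the locale of groups admits record
  extensions.  This locale fixes the record type so that both can be used together.
\<close>

locale word_group = group G for G :: "'a monoid" (structure)
begin

lemma letter_value_closed: "S \<subseteq> carrier G \<Longrightarrow> l \<in> S \<times> UNIV \<Longrightarrow> letter_value G l \<in> carrier G"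
  by (auto simp: letter_value_def)

lemma letter_value_inv_letter:
  "S \<subseteq> carrier G \<Longrightarrow> l \<in> S \<times> UNIV \<Longrightarrow> letter_value G (inv_letter l) = inv letter_value G l"
  by (auto simp: letter_value_def inv_letter_def subset_eq)

lemma letter_action_mult:
  assumes "S \<subseteq> carrier G"
  shows "letter_action S (carrier G) (\<lambda>l g. letter_value G l \<otimes> g)"
  unfolding letter_action_def
  using letter_value_closed[OF assms]
  by (simp add: letter_value_inv_letter[OF assms] m_assoc[symmetric])

lemma word_value_closed:
  assumes "S \<subseteq> carrier G" "w \<in> lists (S \<times> UNIV)"
  shows "word_value G w \<in> carrier G"
  unfolding word_value_foldr
  by (rule letter_action_closed[OF letter_action_mult[OF assms(1)] assms(2)]) simp

lemma foldr_letter_value: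
  assumes "S \<subseteq> carrier G" "w \<in> lists (S \<times> UNIV)" "g \<in> carrier G"
  shows "foldr (\<lambda>l g. letter_value G l \<otimes> g) w g = word_value G w \<otimes> g"
  using assms(2)
  by (induction w)
    (use assms in \<open>auto simp: m_assoc letter_value_closed[OF assms(1)] word_value_closed[OF assms(1)]\<close>)

lemma word_value_append:
  assumes "S \<subseteq> carrier G" "v \<in> lists (S \<times> UNIV)" "w \<in> lists (S \<times> UNIV)"
  shows "word_value G (v @ w) = word_value G v \<otimes> word_value G w"
  using foldr_letter_value[OF assms(1,2) word_value_closed[OF assms(1,3)]]
  by (simp add: word_value_foldr)

lemma word_value_inverse:
  assumes "S \<subseteq> carrier G" "w \<in> lists (S \<times> UNIV)"
  shows "word_value G (rev (map inv_letter w)) = inv (word_value G w)"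
proof -
  have "rev (map inv_letter w) \<in> lists (S \<times> UNIV)"
    using assms(2) by (auto simp: in_lists_conv_set inv_letter_def)
  moreover have "word_value G (rev (map inv_letter w)) \<otimes> word_value G w = \<one>"
    using letter_action_inverse[OF letter_action_mult[OF assms(1)] assms(2) one_closed]
    by (simp add: foldr_letter_value[OF assms(1)] calculation word_value_closed[OF assms] assms)
  ultimately show ?thesis
    using word_value_closed[OF assms(1)] assms(2) by (metis inv_equality)
qed

lemma word_value_normal_form:
  assumes "S \<subseteq> carrier G" "w \<in> lists (S \<times> UNIV)"
  shows "word_value G (foldr cancel_cons w []) = word_value G w"
  unfolding word_value_foldr
  by (rule letter_action_normal_form[OF letter_action_mult[OF assms(1)] assms(2)]) simp

text \<open>
  The universal property of a free basis in the form used below: an action given on letters depends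
  only on the group element that a word represents, because two words with the same value have the
  same reduced form.
\<close>

lemma letter_action_eq_of_value_eq:
  assumes S: "S \<subseteq> carrier G" and inj: "inj_on (word_value G) (reduced_words S)"
    and act: "letter_action S M act" and x: "x \<in> M"
    and v: "v \<in> lists (S \<times> UNIV)" and w: "w \<in> lists (S \<times> UNIV)"
    and eq: "word_value G v = word_value G w"
  shows "foldr act v x = foldr act w x"
proof -
  have "foldr cancel_cons v [] = foldr cancel_cons w []"
    using inj by (rule inj_onD)
      (simp_all add: word_value_normal_form[OF S] v w eq foldr_cancel_cons_reduced)
  then show ?thesis
    using letter_action_normal_form[OF act v x] letter_action_normal_form[OF act w x] by simp
qed

lemma generate_eq_reduced_words:
  assumes S: "S \<subseteq> carrier G"
  shows "generate G S = word_value G ` reduced_words S"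
proof
  have "word_value G w \<in> generate G S" if "w \<in> lists (S \<times> UNIV)" for w
    using that
  proof (induction w)
    case (Cons l w)
    then have "letter_value G l \<in> generate G S"
      by (auto simp: letter_value_def intro: generate.incl generate.inv)
    then show ?case using Cons by (simp add: generate.eng)
  qed (simp add: generate.one)
  then show "word_value G ` reduced_words S \<subseteq> generate G S"
    by (auto simp: reduced_words_eq)
  have words: "\<exists>w \<in> lists (S \<times> UNIV). word_value G w = g" if "g \<in> generate G S" for g
    using that
  proof (induction rule: generate.induct)
    case one
    show ?case by (rule bexI[of _ "[]"]) auto
  next
    case (incl h)
    then show ?case
      using S by (intro bexI[of _ "[(h, True)]"]) (auto simp: letter_value_def)
  next
    case (inv h)
    then show ?case
      using S by (intro bexI[of _ "[(h, False)]"]) (auto simp: letter_value_def)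
  next
    case (eng h1 h2)
    then obtain v w where "v \<in> lists (S \<times> UNIV)" "word_value G v = h1"
      "w \<in> lists (S \<times> UNIV)" "word_value G w = h2" by auto
    then show ?case by (intro bexI[of _ "v @ w"]) (auto simp: word_value_append[OF S])
  qed
  show "generate G S \<subseteq> word_value G ` reduced_words S"
  proof (intro subsetI)
    fix g assume "g \<in> generate G S"
    then obtain w where w: "w \<in> lists (S \<times> UNIV)" "word_value G w = g"
      using words by auto
    then have "word_value G (foldr cancel_cons w []) = g"
      by (simp add: word_value_normal_form[OF S])
    then show "g \<in> word_value G ` reduced_words S"
      using foldr_cancel_cons_reduced[OF w(1) Nil_reduced] by blast
  qed
qed

lemma word_value_subgroup:
  assumes "subgroup K G" "S \<subseteq> K" "w \<in> lists (S \<times> UNIV)"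
  shows "word_value (G\<lparr>carrier := K\<rparr>) w = word_value G w"
  using assms(3)
  by (induction w) (use assms in \<open>auto simp: letter_value_def\<close>)

lemma free_group_generate:
  assumes S: "S \<subseteq> carrier G" and inj: "inj_on (word_value G) (reduced_words S)"
  shows "free_group (G\<lparr>carrier := generate G S\<rparr>)"
proof -
  have sub: "subgroup (generate G S) G" by (rule generate_is_subgroup[OF S])
  have SS: "S \<subseteq> generate G S" by (auto intro: generate.incl)
  have "bij_betw (word_value G) (reduced_words S) (generate G S)"
    using inj generate_eq_reduced_words[OF S] by (simp add: bij_betw_def)
  moreover have "bij_betw (word_value (G\<lparr>carrier := generate G S\<rparr>)) (reduced_words S) (generate G S)
     = bij_betw (word_value G) (reduced_words S) (generate G S)"
    by (rule bij_betw_cong) (auto intro: word_value_subgroup[OF sub SS] simp: reduced_words_eq)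
  ultimately show ?thesis
    unfolding free_group_def using subgroup_imp_group[OF sub] SS by auto
qed

end

section \<open>The Nielsen-Schreier theorem\<close>

text \<open>
  Lengths are compared first and ties are broken lexicographically along a well-order of the letters.
  This makes adding a letter on the left monotone, which is what a Schreier transversal needs.
\<close>

lemma shortlex_order:
  obtains lt :: "'l list rel" where "wf lt" "\<forall>v w. v = w \<or> (v, w) \<in> lt \<or> (w, v) \<in> lt"
    "\<forall>l v w. (v, w) \<in> lt \<longrightarrow> (l # v, l # w) \<in> lt" "\<forall>w. (w, []) \<notin> lt"
proof -
  obtain r :: "'l rel" where r: "Well_order r" "Field r = UNIV"
    using well_ordering[where 'a = 'l] by auto
  then have wf: "wf (r - Id)" and "total_on UNIV r"
    by (simp_all add: well_order_on_def linear_order_on_def)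
  then have "total (r - Id)" by (simp add: total_on_def)
  then have "total (lenlex (r - Id))" by (rule total_lenlex)
  then have "v = w \<or> (v, w) \<in> lenlex (r - Id) \<or> (w, v) \<in> lenlex (r - Id)" for v w
    unfolding total_on_def by blast
  with wf_lenlex[OF wf] show thesis
    by (intro that[of "lenlex (r - Id)"]) (auto simp: Cons_lenlex_iff)
qed

context group
begin

lemma mult_inv_cancel: "x \<in> carrier G \<Longrightarrow> y \<in> carrier G \<Longrightarrow> x \<otimes> (inv x \<otimes> y) = y"
  by (simp add: m_assoc[symmetric])

lemma inv_mult_cancel: "x \<in> carrier G \<Longrightarrow> y \<in> carrier G \<Longrightarrow> inv x \<otimes> (x \<otimes> y) = y"
  by (simp add: m_assoc[symmetric])

lemmas group_word_simps = m_assoc inv_mult_group mult_inv_cancel inv_mult_cancel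

lemma mult_mem_subgroup_iff:
  assumes "subgroup K G" "x \<in> carrier G" "k \<in> K"
  shows "x \<otimes> k \<in> K \<longleftrightarrow> x \<in> K"
proof -
  interpret K: subgroup K G by fact
  have "x \<in> K" if "x \<otimes> k \<in> K"
  proof -
    have "x \<otimes> k \<otimes> inv k \<in> K" using that assms(3) by simp
    then show "x \<in> K" using assms by (simp add: m_assoc)
  qed
  then show ?thesis using assms(3) by auto
qed

end

text \<open>
  A Schreier transversal, seen as a function: \<open>\<tau> f\<close> is a word over the basis that represents an
  element of the coset \<open>f K\<close> and depends only on that coset.  The chosen words are closed under
  suffixes, which says that they are the paths of a spanning tree in the graph of cosets.
\<close>

locale schreier_transversal = word_group +
  fixes S K :: "'a set" and \<tau> :: "'a \<Rightarrow> ('a \<times> bool) list"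
  assumes S: "S \<subseteq> carrier G" and K: "subgroup K G"
    and rep_word: "f \<in> carrier G \<Longrightarrow> \<tau> f \<in> lists (S \<times> UNIV)"
    and rep_coset: "f \<in> carrier G \<Longrightarrow> inv (word_value G (\<tau> f)) \<otimes> f \<in> K"
    and rep_mult: "f \<in> carrier G \<Longrightarrow> k \<in> K \<Longrightarrow> \<tau> (f \<otimes> k) = \<tau> f"
    and rep_suffix: "f \<in> carrier G \<Longrightarrow> \<tau> f = l # w \<Longrightarrow> \<tau> (word_value G w) = w"
    and rep_one: "\<tau> \<one> = []"

text \<open>
  Every coset contains a least word in the shortlex order.  Suffix closure is automatic: if \<open>w\<close> could
  be replaced by a smaller word of its coset, then the same replacement would make \<open>l # w\<close> smaller.
\<close>

lemma (in word_group) schreier_transversal_exists: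
  assumes S: "S \<subseteq> carrier G" and gen: "carrier G \<subseteq> generate G S" and K: "subgroup K G"
  obtains \<tau> where "schreier_transversal G S K \<tau>"
proof -
  interpret K: subgroup K G by fact
  obtain lt :: "('a \<times> bool) list rel" where wf: "wf lt"
    and total: "\<forall>v w. v = w \<or> (v, w) \<in> lt \<or> (w, v) \<in> lt"
    and cons: "\<forall>l v w. (v, w) \<in> lt \<longrightarrow> (l # v, l # w) \<in> lt" and nil: "\<forall>w. (w, []) \<notin> lt"
    by (rule shortlex_order)
  define reps where
    "reps f = {w \<in> lists (S \<times> UNIV). inv (word_value G w) \<otimes> f \<in> K}" for f
  define least where "least f w \<longleftrightarrow> w \<in> reps f \<and> (\<forall>v. (v, w) \<in> lt \<longrightarrow> v \<notin> reps f)" for f w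
  have least_unique: "v = w" if "least f v" "least f w" for f v w
    using total[rule_format, of v w] that by (auto simp: least_def)
  have "\<exists>w. least f w" if f: "f \<in> carrier G" for f
  proof -
    have "f \<in> word_value G ` reduced_words S"
      using f gen by (auto simp: generate_eq_reduced_words[OF S])
    then obtain w where "w \<in> reduced_words S" "f = word_value G w" by auto
    then have "w \<in> reps f"
      using f by (simp add: reps_def reduced_words_eq)
    then have "\<exists>z \<in> reps f. \<forall>v. (v, z) \<in> lt \<longrightarrow> v \<notin> reps f"
      using wf unfolding wf_eq_minimal by (elim allE impE) auto
    then show ?thesis unfolding least_def by blast
  qed
  then have "\<forall>f \<in> carrier G. \<exists>w. least f w" by blast
  from bchoice[OF this] obtain \<tau> where \<tau>: "\<forall>f \<in> carrier G. least f (\<tau> f)" ..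
  have reps_mult: "reps (f \<otimes> k) = reps f" if f: "f \<in> carrier G" and k: "k \<in> K" for f k
  proof -
    have "inv (word_value G w) \<otimes> (f \<otimes> k) \<in> K \<longleftrightarrow> inv (word_value G w) \<otimes> f \<in> K"
      if w: "w \<in> lists (S \<times> UNIV)" for w
      using mult_mem_subgroup_iff[OF K _ k, of "inv (word_value G w) \<otimes> f"]
        f k word_value_closed[OF S w] by (simp add: m_assoc)
    then show ?thesis by (auto simp: reps_def)
  qed
  have "schreier_transversal G S K \<tau>"
  proof (intro schreier_transversal.intro schreier_transversal_axioms.intro word_group_axioms)
    show "S \<subseteq> carrier G" "subgroup K G" by fact+
    fix f assume f: "f \<in> carrier G"
    show "\<tau> f \<in> lists (S \<times> UNIV)" "inv (word_value G (\<tau> f)) \<otimes> f \<in> K"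
      using \<tau>[rule_format, OF f] by (auto simp: least_def reps_def)
    show "\<tau> (f \<otimes> k) = \<tau> f" if k: "k \<in> K" for k
    proof -
      have "f \<otimes> k \<in> carrier G" using f k by simp
      from \<tau>[rule_format, OF this] have "least f (\<tau> (f \<otimes> k))" unfolding least_def reps_mult[OF f k] .
      then show ?thesis using \<tau>[rule_format, OF f] least_unique by blast
    qed
    show "\<tau> (word_value G w) = w" if eq: "\<tau> f = l # w" for l w
    proof -
      have lw: "least f (l # w)" using \<tau>[rule_format, OF f] eq by simp
      then have l: "l \<in> S \<times> UNIV" and w: "w \<in> lists (S \<times> UNIV)"
        and in_K: "inv (letter_value G l \<otimes> word_value G w) \<otimes> f \<in> K"
        by (auto simp: least_def reps_def)
      note closed = word_value_closed[OF S] letter_value_closed[OF S l]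
      have "l # v \<in> reps f" if v: "v \<in> reps (word_value G w)" for v
      proof -
        have v': "v \<in> lists (S \<times> UNIV)" "inv (word_value G v) \<otimes> word_value G w \<in> K"
          using v by (auto simp: reps_def)
        have "inv (letter_value G l \<otimes> word_value G v) \<otimes> f
            = (inv (word_value G v) \<otimes> word_value G w) \<otimes> (inv (letter_value G l \<otimes> word_value G w) \<otimes> f)"
          using closed(1)[OF v'(1)] closed(1)[OF w] closed(2) f
          by (simp add: group_word_simps)
        then show ?thesis using K.m_closed[OF v'(2) in_K] v'(1) l by (simp add: reps_def)
      qed
      moreover have "w \<in> reps (word_value G w)"
        using w closed(1)[OF w] by (simp add: reps_def)
      ultimately have "least (word_value G w) w"
        using lw cons unfolding least_def by blast
      then show ?thesis using \<tau>[rule_format, OF closed(1)[OF w]] least_unique by blast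
    qed
  next
    have "least \<one> []" using nil by (simp add: least_def reps_def)
    then show "\<tau> \<one> = []" using \<tau>[rule_format, OF one_closed] least_unique by blast
  qed
  then show thesis by (rule that)
qed

context schreier_transversal
begin

sublocale K: subgroup K G by (rule K)

definition rep :: "'a \<Rightarrow> 'a" where "rep f = word_value G (\<tau> f)"

text \<open>
  The element of \<open>K\<close> obtained by walking along the tree to the coset of \<open>f\<close>, then along the edge
  labelled \<open>s\<close>, and back along the tree.
\<close>

definition schreier_gen :: "'a \<Rightarrow> 'a \<Rightarrow> 'a" where
  "schreier_gen s f = inv (rep (s \<otimes> f)) \<otimes> (s \<otimes> rep f)"

definition schreier_basis :: "'a set" where
  "schreier_basis = {schreier_gen s f | s f. s \<in> S \<and> f \<in> carrier G} - {\<one>}"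

text \<open>
  The action behind the proof.  The first component follows the walk described by a word in \<open>G\<close>; the
  second one records, as a reduced word, the Schreier generators of the edges that the walk crosses.
  An edge whose generator is trivial records nothing.  Traversing the edge labelled \<open>s\<close> backwards
  from \<open>f\<close> means that it starts at \<open>inv s \<otimes> f\<close>, which explains the argument of \<open>schreier_gen\<close>.
\<close>

definition act :: "'a \<times> bool \<Rightarrow> 'a \<times> ('a \<times> bool) list \<Rightarrow> 'a \<times> ('a \<times> bool) list" where
  "act l = (\<lambda>(f, w).
     let y = schreier_gen (fst l) (if snd l then f else inv (fst l) \<otimes> f)
     in (letter_value G l \<otimes> f, if y = \<one> then w else cancel_cons (y, snd l) w))"

lemma S_closed [simp]: "s \<in> S \<Longrightarrow> s \<in> carrier G"
  using S by blast

lemma rep_closed [simp]: "f \<in> carrier G \<Longrightarrow> rep f \<in> carrier G"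
  by (simp add: rep_def word_value_closed[OF S rep_word])

lemma rep_one_eq [simp]: "rep \<one> = \<one>"
  by (simp add: rep_def rep_one)

lemma rep_mult_eq: "f \<in> carrier G \<Longrightarrow> k \<in> K \<Longrightarrow> rep (f \<otimes> k) = rep f"
  by (simp add: rep_def rep_mult)

lemma schreier_gen_closed [simp]: "s \<in> S \<Longrightarrow> f \<in> carrier G \<Longrightarrow> schreier_gen s f \<in> carrier G"
  by (simp add: schreier_gen_def)

lemma schreier_gen_mult:
  "s \<in> S \<Longrightarrow> f \<in> carrier G \<Longrightarrow> k \<in> K \<Longrightarrow> schreier_gen s (f \<otimes> k) = schreier_gen s f"
  using rep_mult_eq[of "s \<otimes> f" k] by (simp add: schreier_gen_def rep_mult_eq m_assoc)

lemma rep_eq_mult: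
  assumes "f \<in> carrier G"
  obtains k where "k \<in> K" "rep f = f \<otimes> k"
proof
  show "inv (inv (rep f) \<otimes> f) \<in> K" using rep_coset[OF assms] by (simp add: rep_def)
  show "rep f = f \<otimes> inv (inv (rep f) \<otimes> f)"
    using assms by (simp add: group_word_simps)
qed

lemma rep_word_rep:
  assumes "f \<in> carrier G"
  shows "\<tau> (rep f) = \<tau> f"
proof -
  obtain k where "k \<in> K" "rep f = f \<otimes> k" using rep_eq_mult[OF assms] .
  then show ?thesis using rep_mult[OF assms] by simp
qed

lemma schreier_gen_mem:
  assumes "s \<in> S" "f \<in> carrier G"
  shows "schreier_gen s f \<in> K"
proof -
  have "schreier_gen s f = (inv (rep (s \<otimes> f)) \<otimes> (s \<otimes> f)) \<otimes> inv (inv (rep f) \<otimes> f)"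
    using assms by (simp add: schreier_gen_def group_word_simps)
  then show ?thesis
    using rep_coset[of f] rep_coset[of "s \<otimes> f"] assms by (simp add: rep_def)
qed

lemma schreier_basis_subset: "schreier_basis \<subseteq> K"
  by (auto simp: schreier_basis_def schreier_gen_mem)

lemma schreier_basis_closed: "schreier_basis \<subseteq> carrier G"
  using schreier_basis_subset K.subset by blast

lemma letter_action_act:
  "letter_action S (carrier G \<times> reduced_words schreier_basis) act"
proof -
  have "act (s, b) (f, w) \<in> carrier G \<times> reduced_words schreier_basis \<and>
      act (inv_letter (s, b)) (act (s, b) (f, w)) = (f, w)"
    if "s \<in> S" "f \<in> carrier G" "w \<in> reduced_words schreier_basis" for s b f w
  proof -
    define g where "g = (if b then f else inv s \<otimes> f)"
    define y where "y = schreier_gen s g"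
    have "g \<in> carrier G" using that by (simp add: g_def)
    then have y: "y = \<one> \<or> y \<in> schreier_basis"
      using that by (auto simp: y_def schreier_basis_def)
    have 1: "act (s, b) (f, w) =
        (letter_value G (s, b) \<otimes> f, if y = \<one> then w else cancel_cons (y, b) w)"
      by (simp add: act_def y_def g_def Let_def)
    have "(if \<not> b then letter_value G (s, b) \<otimes> f
        else inv s \<otimes> (letter_value G (s, b) \<otimes> f)) = g"
      using that by (simp add: g_def letter_value_def group_word_simps)
    then have 2: "act (s, \<not> b) (letter_value G (s, b) \<otimes> f, v) =
        (f, if y = \<one> then v else cancel_cons (y, \<not> b) v)" for v
      using that by (auto simp: act_def y_def Let_def letter_value_def group_word_simps)
    have "cancel_cons (y, \<not> b) (cancel_cons (y, b) w) = w"
      using cancel_cons_inv_letter[OF that(3), of "(y, b)"] by (simp add: inv_letter_def)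
    moreover have "cancel_cons (y, b) w \<in> reduced_words schreier_basis" if "y \<noteq> \<one>"
      using y that cancel_cons_reduced[OF _ \<open>w \<in> _\<close>, of "(y, b)"] by auto
    ultimately show ?thesis
      using that letter_value_closed[OF S, of "(s, b)"] by (simp add: 1 2 inv_letter_def)
  qed
  then show ?thesis unfolding letter_action_def by auto
qed

text \<open>
  The tree words cross only edges of the tree, whose Schreier generators are trivial, so they leave
  the recorded word unchanged.
\<close>

lemma act_transversal_word:
  assumes "v \<in> lists (S \<times> UNIV)" "\<tau> (word_value G v) = v" "k \<in> K"
  shows "foldr act v (k, w) = (word_value G v \<otimes> k, w)"
  using assms(1,2)
proof (induction v)
  case Nil
  then show ?case using \<open>k \<in> K\<close> by simp
next
  case (Cons l v)
  obtain s b where l: "l = (s, b)" "s \<in> S" using Cons by auto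
  have v: "v \<in> lists (S \<times> UNIV)" and lv: "l # v \<in> lists (S \<times> UNIV)"
    and \<tau>lv: "\<tau> (word_value G (l # v)) = l # v"
    using Cons by auto
  note closed = word_value_closed[OF S v] word_value_closed[OF S lv] letter_value_closed[OF S, of l]
  have \<tau>v: "\<tau> (word_value G v) = v" using rep_suffix[OF closed(2) \<tau>lv] .
  have reps: "rep (word_value G v) = word_value G v"
    "rep (letter_value G l \<otimes> word_value G v) = letter_value G l \<otimes> word_value G v"
    using \<tau>v \<tau>lv by (simp_all add: rep_def)
  let ?g = "if b then word_value G v else inv s \<otimes> word_value G v"
  have "schreier_gen s ?g = \<one>"
    using reps l closed by (cases b) (auto simp: schreier_gen_def letter_value_def group_word_simps)
  moreover have "(if b then word_value G v \<otimes> k else inv s \<otimes> (word_value G v \<otimes> k)) = ?g \<otimes> k"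
    using closed l \<open>k \<in> K\<close> by (simp add: m_assoc)
  moreover have "schreier_gen s (?g \<otimes> k) = schreier_gen s ?g"
    using l closed \<open>k \<in> K\<close> by (intro schreier_gen_mult) auto
  ultimately have step: "act l (word_value G v \<otimes> k, w) = (letter_value G l \<otimes> (word_value G v \<otimes> k), w)"
    by (cases b) (simp_all add: act_def l)
  have "foldr act v (k, w) = (word_value G v \<otimes> k, w)" using Cons v \<tau>v by blast
  then show ?case using step closed l \<open>k \<in> K\<close> by (simp add: m_assoc)
qed

text \<open>
  A nontrivial Schreier generator is represented by a loop that follows the tree, crosses one edge
  and returns along the tree.  Only the middle edge is recorded.
\<close>

lemma act_schreier_gen:
  assumes "y \<in> schreier_basis"
  obtains E where "E \<in> lists (S \<times> UNIV)" "word_value G E = y"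
    "\<forall>k \<in> K. \<forall>w \<in> reduced_words schreier_basis.
       foldr act E (k, w) = (y \<otimes> k, cancel_cons (y, True) w)"
proof -
  obtain s f where s: "s \<in> S" and f: "f \<in> carrier G" and y: "y = schreier_gen s f" "y \<noteq> \<one>"
    using assms by (auto simp: schreier_basis_def)
  \<comment> \<open>The way back along the tree.\<close>
  let ?r = "rev (map inv_letter (\<tau> (s \<otimes> f)))"
  have words: "\<tau> f \<in> lists (S \<times> UNIV)" "\<tau> (s \<otimes> f) \<in> lists (S \<times> UNIV)"
    using rep_word f s by simp_all
  have r: "?r \<in> lists (S \<times> UNIV)"
    using words(2) by (auto simp: in_lists_conv_set inv_letter_def)
  show thesis
  proof (intro that ballI)
    show "?r @ (s, True) # \<tau> f \<in> lists (S \<times> UNIV)" using words r s by simp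
    have "word_value G (?r @ (s, True) # \<tau> f) = word_value G ?r \<otimes> word_value G ((s, True) # \<tau> f)"
      by (rule word_value_append[OF S r]) (use words s in auto)
    then show "word_value G (?r @ (s, True) # \<tau> f) = y"
      by (simp add: word_value_inverse[OF S words(2)] y schreier_gen_def rep_def letter_value_def)
    fix k w assume k: "k \<in> K" and w: "w \<in> reduced_words schreier_basis"
    obtain k' where k': "k' \<in> K" "rep f = f \<otimes> k'" using rep_eq_mult[OF f] .
    have "schreier_gen s (rep f \<otimes> k) = y"
      using s f k k' by (simp add: y schreier_gen_mult)
    then have step: "act (s, True) (rep f \<otimes> k, w) = (s \<otimes> (rep f \<otimes> k), cancel_cons (y, True) w)"
      using y by (simp add: act_def letter_value_def)
    have tree: "foldr act (\<tau> g) (h, v) = (rep g \<otimes> h, v)" if "g \<in> carrier G" "h \<in> K" for g h v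
      using act_transversal_word[OF rep_word[OF that(1)] _ that(2)] rep_word_rep[OF that(1)]
      by (simp add: rep_def)
    have "y \<in> K" using s f y schreier_gen_mem by simp
    then have yk: "y \<otimes> k \<in> K" using k by simp
    have "rep (s \<otimes> f) \<otimes> (y \<otimes> k) = s \<otimes> (rep f \<otimes> k)"
      using s f k by (simp add: y schreier_gen_def group_word_simps)
    then have forward: "foldr act (\<tau> (s \<otimes> f)) (y \<otimes> k, cancel_cons (y, True) w)
        = (s \<otimes> (rep f \<otimes> k), cancel_cons (y, True) w)"
      using tree[of "s \<otimes> f", OF _ yk] s f by simp
    have "(y \<otimes> k, cancel_cons (y, True) w) \<in> carrier G \<times> reduced_words schreier_basis"
      using yk w assms by (auto intro: cancel_cons_reduced)
    from letter_action_inverse[OF letter_action_act words(2) this]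
    have "foldr act ?r (s \<otimes> (rep f \<otimes> k), cancel_cons (y, True) w)
        = (y \<otimes> k, cancel_cons (y, True) w)"
      unfolding forward .
    then show "foldr act (?r @ (s, True) # \<tau> f) (k, w) = (y \<otimes> k, cancel_cons (y, True) w)"
      using tree[OF f k] step by simp
  qed
qed

lemma act_letter:
  assumes "l \<in> schreier_basis \<times> UNIV"
  obtains E where "E \<in> lists (S \<times> UNIV)" "word_value G E = letter_value G l"
    "\<forall>k \<in> K. \<forall>w \<in> reduced_words schreier_basis.
       foldr act E (k, w) = (letter_value G l \<otimes> k, cancel_cons l w)"
proof -
  obtain y b where l: "l = (y, b)" and y: "y \<in> schreier_basis" using assms by auto
  have yK: "y \<in> K" using y schreier_basis_subset by auto
  obtain E where E: "E \<in> lists (S \<times> UNIV)" "word_value G E = y"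
    and act_E: "\<forall>k \<in> K. \<forall>w \<in> reduced_words schreier_basis.
       foldr act E (k, w) = (y \<otimes> k, cancel_cons (y, True) w)"
    using act_schreier_gen[OF y] .
  show thesis
  proof (cases b)
    case True
    then show thesis using E act_E by (intro that[of E]) (auto simp: l letter_value_def)
  next
    case False
    let ?r = "rev (map inv_letter E)"
    show thesis
    proof (intro that ballI)
      show "?r \<in> lists (S \<times> UNIV)" using E by (auto simp: in_lists_conv_set inv_letter_def)
      show "word_value G ?r = letter_value G l"
        using E False by (simp add: word_value_inverse[OF S] l letter_value_def)
      fix k w assume k: "k \<in> K" and w: "w \<in> reduced_words schreier_basis"
      have red: "cancel_cons (y, False) w \<in> reduced_words schreier_basis"
        using y w by (auto intro: cancel_cons_reduced)
      have "cancel_cons (y, True) (cancel_cons (y, False) w) = w"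
        using cancel_cons_inv_letter[OF w, of "(y, False)"] by (simp add: inv_letter_def)
      then have forward: "foldr act E (inv y \<otimes> k, cancel_cons (y, False) w) = (k, w)"
        using act_E[rule_format, OF _ red, of "inv y \<otimes> k"] yK k by (simp add: group_word_simps)
      have "(inv y \<otimes> k, cancel_cons (y, False) w) \<in> carrier G \<times> reduced_words schreier_basis"
        using red yK k by simp
      from letter_action_inverse[OF letter_action_act E(1) this]
      have "foldr act ?r (k, w) = (inv y \<otimes> k, cancel_cons (y, False) w)"
        unfolding forward .
      then show "foldr act ?r (k, w) = (letter_value G l \<otimes> k, cancel_cons l w)"
        using False by (simp add: l letter_value_def)
    qed
  qed
qed

text \<open>
  Translating a word over the Schreier generators letter by letter, the action started at the
  trivial pair returns the reduced form of that word.
\<close>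

lemma act_word:
  assumes "u \<in> lists (schreier_basis \<times> UNIV)"
  shows "\<exists>E \<in> lists (S \<times> UNIV). word_value G E = word_value G u \<and>
    foldr act E (\<one>, []) = (word_value G u, foldr cancel_cons u [])"
  using assms
proof (induction u)
  case Nil
  show ?case by (rule bexI[of _ "[]"]) auto
next
  case (Cons l u)
  then have l: "l \<in> schreier_basis \<times> UNIV" and u: "u \<in> lists (schreier_basis \<times> UNIV)" by auto
  obtain F where F: "F \<in> lists (S \<times> UNIV)" "word_value G F = word_value G u"
    "foldr act F (\<one>, []) = (word_value G u, foldr cancel_cons u [])"
    using Cons by auto
  obtain E where E: "E \<in> lists (S \<times> UNIV)" "word_value G E = letter_value G l"
    "\<forall>k \<in> K. \<forall>w \<in> reduced_words schreier_basis.
       foldr act E (k, w) = (letter_value G l \<otimes> k, cancel_cons l w)"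
    using act_letter[OF l] .
  have "word_value G u \<in> word_value G ` reduced_words schreier_basis"
    unfolding word_value_normal_form[OF schreier_basis_closed u, symmetric]
    by (intro imageI foldr_cancel_cons_reduced[OF u Nil_reduced])
  then have "word_value G u \<in> generate G schreier_basis"
    by (simp add: generate_eq_reduced_words[OF schreier_basis_closed])
  then have "word_value G u \<in> K"
    using generate_subgroup_incl[OF schreier_basis_subset K] by blast
  then show ?case
    using E F foldr_cancel_cons_reduced[OF u Nil_reduced]
    by (intro bexI[of _ "E @ F"]) (auto simp: word_value_append[OF S])
qed

text \<open>
  Two reduced words with the same value translate into words over \<open>S\<close> with the same value.  By
  freeness of \<open>G\<close> these act in the same way, and their actions recover the two reduced words.
\<close>

lemma inj_on_schreier_basis:
  assumes "inj_on (word_value G) (reduced_words S)"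
  shows "inj_on (word_value G) (reduced_words schreier_basis)"
proof (rule inj_onI)
  fix u v assume u: "u \<in> reduced_words schreier_basis" and v: "v \<in> reduced_words schreier_basis"
    and eq: "word_value G u = word_value G v"
  obtain E where E: "E \<in> lists (S \<times> UNIV)" "word_value G E = word_value G u"
    "foldr act E (\<one>, []) = (word_value G u, foldr cancel_cons u [])"
    using act_word[OF reduced_words_lists[OF u]] by blast
  obtain F where F: "F \<in> lists (S \<times> UNIV)" "word_value G F = word_value G v"
    "foldr act F (\<one>, []) = (word_value G v, foldr cancel_cons v [])"
    using act_word[OF reduced_words_lists[OF v]] by blast
  have "foldr act E (\<one>, []) = foldr act F (\<one>, [])"
    using E F eq by (intro letter_action_eq_of_value_eq[OF S assms letter_action_act]) auto
  then show "u = v"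
    using E(3) F(3) by (simp add: foldr_cancel_cons_id[OF u] foldr_cancel_cons_id[OF v])
qed

text \<open>
  Schreier's rewriting: reading a word letter by letter, its deviation from the representative of its
  coset grows by one Schreier generator or the inverse of one.
\<close>

lemma rewriting_process:
  assumes "w \<in> lists (S \<times> UNIV)"
  shows "inv (rep (word_value G w)) \<otimes> word_value G w \<in> generate G schreier_basis"
  using assms
proof (induction w)
  case Nil
  then show ?case by (simp add: generate.one)
next
  case (Cons l w)
  then obtain s b where l: "l = (s, b)" "s \<in> S" and w: "w \<in> lists (S \<times> UNIV)" by auto
  define f where "f = word_value G w"
  have f: "f \<in> carrier G" using word_value_closed[OF S w] by (simp add: f_def)
  have IH: "inv (rep f) \<otimes> f \<in> generate G schreier_basis" using Cons by (simp add: f_def)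
  note sub = generate_is_subgroup[OF schreier_basis_closed]
  have gen: "schreier_gen s g \<in> generate G schreier_basis" if "g \<in> carrier G" for g
  proof (cases "schreier_gen s g = \<one>")
    case True
    then show ?thesis by (simp add: generate.one)
  next
    case False
    then have "schreier_gen s g \<in> schreier_basis" using that l by (auto simp: schreier_basis_def)
    then show ?thesis by (rule generate.incl)
  qed
  show ?case
  proof (cases b)
    case True
    have "inv (rep (s \<otimes> f)) \<otimes> (s \<otimes> f) = schreier_gen s f \<otimes> (inv (rep f) \<otimes> f)"
      using l f by (simp add: schreier_gen_def group_word_simps)
    also have "\<dots> \<in> generate G schreier_basis"
      by (rule generate.eng[OF gen[OF f] IH])
    finally show ?thesis using True by (simp add: l letter_value_def f_def)
  next
    case False
    define g where "g = inv s \<otimes> f"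
    have g: "g \<in> carrier G" using l f by (simp add: g_def)
    have sg: "s \<otimes> g = f" using l f by (simp add: g_def group_word_simps)
    have "inv (rep g) \<otimes> g = inv (rep g) \<otimes> (inv s \<otimes> f)" by (simp add: g_def)
    also have "\<dots> = inv (schreier_gen s g) \<otimes> (inv (rep f) \<otimes> f)"
      using l f g by (simp add: schreier_gen_def sg group_word_simps)
    also have "\<dots> \<in> generate G schreier_basis"
      by (rule generate.eng[OF subgroup.m_inv_closed[OF sub gen[OF g]] IH])
    finally show ?thesis using False by (simp add: l letter_value_def f_def g_def)
  qed
qed

lemma generate_schreier_basis:
  assumes "carrier G \<subseteq> generate G S"
  shows "generate G schreier_basis = K"
proof
  show "generate G schreier_basis \<subseteq> K"
    by (rule generate_subgroup_incl[OF schreier_basis_subset K])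
  show "K \<subseteq> generate G schreier_basis"
  proof
    fix k assume k: "k \<in> K"
    then have "k \<in> word_value G ` reduced_words S"
      using assms K.mem_carrier by (auto simp: generate_eq_reduced_words[OF S])
    then obtain w where "w \<in> lists (S \<times> UNIV)" "k = word_value G w"
      using reduced_words_lists by blast
    moreover have "rep k = \<one>" using rep_mult_eq[OF one_closed k] k by simp
    ultimately show "k \<in> generate G schreier_basis"
      using rewriting_process[of w] k by simp
  qed
qed

end

theorem nielsen_schreier:
  assumes "free_group G" "subgroup K G"
  shows "free_group (G\<lparr>carrier := K\<rparr>)"
proof -
  interpret word_group G
    using assms(1) by (simp add: free_group_def word_group_def)
  obtain S where S: "S \<subseteq> carrier G"
    and inj: "inj_on (word_value G) (reduced_words S)"
    and onto: "word_value G ` reduced_words S = carrier G"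
    using assms(1) by (auto simp: free_group_def bij_betw_def)
  then have gen: "carrier G \<subseteq> generate G S" using generate_eq_reduced_words[OF S] by simp
  obtain \<tau> where "schreier_transversal G S K \<tau>"
    using schreier_transversal_exists[OF S gen assms(2)] .
  then interpret schreier_transversal G S K \<tau> .
  show ?thesis
    using free_group_generate[OF schreier_basis_closed inj_on_schreier_basis[OF inj]]
    by (simp add: generate_schreier_basis[OF gen])
qed

section \<open>Amenability of finite and of cyclic groups\<close>

text \<open>
  The image of an invariant mean under \<open>p\<close> measures a set by its preimage.  It is invariant because
  the preimage of the translate by \<open>p h\<close> is the translate of the preimage by \<open>h\<close>.
\<close>

lemma amenable_groupI_pushforward:
  assumes H: "amenable_group H" and Q: "group Q" and p: "p \<in> epi H Q"
  shows "amenable_group Q"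
proof -
  interpret H: group H using H by (simp add: amenable_group_def)
  interpret Q: group Q by fact
  have hom: "p \<in> hom H Q" and onto: "p ` carrier H = carrier Q" using p by (auto simp: epi_def)
  interpret p: group_hom H Q p
    using H.group_axioms Q hom by (simp add: group_hom_def group_hom_axioms_def)
  obtain \<nu> :: "'a set \<Rightarrow> real" where
    pos: "\<forall>E \<subseteq> carrier H. 0 \<le> \<nu> E" and tot: "\<nu> (carrier H) = 1" and
    add: "\<forall>E \<subseteq> carrier H. \<forall>F \<subseteq> carrier H. E \<inter> F = {} \<longrightarrow> \<nu> (E \<union> F) = \<nu> E + \<nu> F" and
    inv: "\<forall>g \<in> carrier H. \<forall>E \<subseteq> carrier H. \<nu> (g <#\<^bsub>H\<^esub> E) = \<nu> E"
    using H unfolding amenable_group_def by (elim conjE exE) (rule that)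
  define pre where "pre E = {h \<in> carrier H. p h \<in> E}" for E
  have shift: "pre (p h <#\<^bsub>Q\<^esub> E) = h <#\<^bsub>H\<^esub> pre E" if h: "h \<in> carrier H" and E: "E \<subseteq> carrier Q" for h E
  proof (intro equalityI subsetI)
    fix x assume "x \<in> pre (p h <#\<^bsub>Q\<^esub> E)"
    then obtain e where x: "x \<in> carrier H" and e: "e \<in> E" "p x = p h \<otimes>\<^bsub>Q\<^esub> e"
      by (auto simp: pre_def l_coset_def)
    have "p (inv\<^bsub>H\<^esub> h \<otimes>\<^bsub>H\<^esub> x) = inv\<^bsub>Q\<^esub> (p h) \<otimes>\<^bsub>Q\<^esub> (p h \<otimes>\<^bsub>Q\<^esub> e)"
      using h x e by simp
    also have "\<dots> = e"
      using h e E by (simp add: Q.m_assoc[symmetric] subsetD)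
    finally have "inv\<^bsub>H\<^esub> h \<otimes>\<^bsub>H\<^esub> x \<in> pre E" using e h x by (simp add: pre_def)
    moreover have "x = h \<otimes>\<^bsub>H\<^esub> (inv\<^bsub>H\<^esub> h \<otimes>\<^bsub>H\<^esub> x)"
      using h x by (simp add: H.m_assoc[symmetric])
    ultimately show "x \<in> h <#\<^bsub>H\<^esub> pre E" by (auto simp: l_coset_def)
  qed (use h hom in \<open>auto simp: pre_def l_coset_def hom_mult\<close>)
  have sub: "pre E \<subseteq> carrier H" for E by (auto simp: pre_def)
  show ?thesis
    unfolding amenable_group_def
  proof (intro conjI exI[of _ "\<lambda>E. \<nu> (pre E)"] allI ballI impI)
    show "\<nu> (pre (carrier Q)) = 1"
      using tot hom by (simp add: pre_def hom_in_carrier cong: conj_cong)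
    show "\<nu> (pre (E \<union> F)) = \<nu> (pre E) + \<nu> (pre F)" if "E \<inter> F = {}" for E F
    proof -
      have "pre (E \<union> F) = pre E \<union> pre F" "pre E \<inter> pre F = {}" using that by (auto simp: pre_def)
      then show ?thesis using add sub by simp
    qed
    fix q E assume "q \<in> carrier Q" "E \<subseteq> carrier Q"
    moreover then obtain h where "h \<in> carrier H" "q = p h" using onto by auto
    ultimately show "\<nu> (pre (q <#\<^bsub>Q\<^esub> E)) = \<nu> (pre E)"
      by (simp add: shift inv sub)
  qed (use Q pos sub in auto)
qed

lemma finite_group_amenable:
  assumes "group G" "finite (carrier G)"
  shows "amenable_group G"
proof -
  interpret group G by fact
  have "carrier G \<noteq> {}" by auto
  then have c: "card (carrier G) \<noteq> 0" using assms by simp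
  show ?thesis
    unfolding amenable_group_def
  proof (intro conjI exI[of _ "\<lambda>E. card E / card (carrier G)"] allI ballI impI)
    show "real (card (E \<union> F)) / card (carrier G) = card E / card (carrier G) + card F / card (carrier G)"
      if "E \<subseteq> carrier G" "F \<subseteq> carrier G" "E \<inter> F = {}" for E F
      using that assms by (simp add: card_Un_disjoint finite_subset add_divide_distrib)
    show "real (card (g <#\<^bsub>G\<^esub> E)) / card (carrier G) = card E / card (carrier G)"
      if "g \<in> carrier G" "E \<subseteq> carrier G" for g E
    proof -
      have "g <#\<^bsub>G\<^esub> E = (\<lambda>x. g \<otimes>\<^bsub>G\<^esub> x) ` E" by (auto simp: l_coset_def)
      moreover have "inj_on (\<lambda>x. g \<otimes>\<^bsub>G\<^esub> x) E" using that l_cancel by (intro inj_onI) blast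
      ultimately show ?thesis by (simp add: card_image)
    qed
  qed (use assms c in auto)
qed

text \<open>
  The uniform measures on the intervals \<open>{0..n}\<close> are finitely additive and almost invariant, since
  translation by \<open>1\<close> changes the number of points of a set in \<open>{0..n}\<close> by at most \<open>1\<close>.  The set
  \<open>K n\<close> of all finitely additive probability measures that are invariant up to \<open>1 / (n + 1)\<close> is
  closed in a product of copies of the unit interval, which is compact by Tychonoff's theorem.  The
  sets \<open>K n\<close> are nonempty and decreasing, and a common element of all of them is an invariant mean.
\<close>

lemma amenable_integer_group: "amenable_group integer_group"
proof -
  define K :: "nat \<Rightarrow> (int set \<Rightarrow> real) set" where
    "K n = {\<nu>. (\<forall>E. 0 \<le> \<nu> E \<and> \<nu> E \<le> 1) \<and> \<nu> UNIV = 1 \<and>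
       (\<forall>E F. E \<inter> F = {} \<longrightarrow> \<nu> (E \<union> F) = \<nu> E + \<nu> F) \<and>
       (\<forall>E. \<bar>\<nu> ((\<lambda>x. x + 1) ` E) - \<nu> E\<bar> \<le> 1 / Suc n)}" for n
  have cont: "continuous_on UNIV (\<lambda>\<nu> :: int set \<Rightarrow> real. \<nu> E)" for E
    by simp
  have closed: "closed (K n)" for n
  proof -
    have "closed {\<nu> :: int set \<Rightarrow> real. 0 \<le> \<nu> E}" "closed {\<nu> :: int set \<Rightarrow> real. \<nu> E \<le> 1}"
      "closed {\<nu> :: int set \<Rightarrow> real. \<nu> E = 1}" for E
      by (intro closed_Collect_le closed_Collect_eq continuous_on_const cont)+
    moreover have "closed {\<nu> :: int set \<Rightarrow> real. \<nu> (E \<union> F) = \<nu> E + \<nu> F}" for E F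
      by (intro closed_Collect_eq continuous_on_add cont)
    moreover have "closed {\<nu> :: int set \<Rightarrow> real. \<bar>\<nu> ((\<lambda>x. x + 1) ` E) - \<nu> E\<bar> \<le> 1 / Suc n}" for E
      by (intro closed_Collect_le continuous_on_rabs continuous_on_diff continuous_on_const cont)
    ultimately show ?thesis
      unfolding K_def
      by (intro closed_Collect_conj closed_Collect_all closed_Collect_imp open_Collect_const) auto
  qed
  have box: "compact (PiE UNIV (\<lambda>_ :: int set. {0..1 :: real}))"
    using compactin_PiE[of "\<lambda>_. euclidean :: real topology" "UNIV :: int set set" "\<lambda>_. {0..1}"]
    by (simp add: euclidean_product_topology)
  have cpt: "compact (K n)" for n
  proof -
    have "K n \<inter> PiE UNIV (\<lambda>_. {0..1}) = K n" by (auto simp: K_def)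
    then show ?thesis using closed_Int_compact[OF closed box, of n] by simp
  qed
  have mono: "K m \<subseteq> K n" if "n \<le> m" for m n
  proof -
    have "1 / real (Suc m) \<le> 1 / Suc n" using that by (simp add: frac_le)
    then show ?thesis unfolding K_def by (auto intro: order_trans)
  qed
  have ne: "K n \<noteq> {}" for n
  proof -
    let ?I = "{0..int n}"
    define \<nu> where "\<nu> E = card (E \<inter> ?I) / Suc n" for E
    have "card (E \<inter> ?I) \<le> Suc n" for E
      using card_mono[of ?I "E \<inter> ?I"] by simp
    then have "real (card (E \<inter> ?I)) \<le> real (Suc n)" for E by (simp only: of_nat_le_iff)
    then have "\<nu> E \<le> 1" for E by (simp add: \<nu>_def)
    moreover have "\<nu> (E \<union> F) = \<nu> E + \<nu> F" if "E \<inter> F = {}" for E F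
    proof -
      have "card ((E \<union> F) \<inter> ?I) = card (E \<inter> ?I) + card (F \<inter> ?I)"
        using that by (subst card_Un_disjoint[symmetric]) (auto simp: Int_Un_distrib2)
      then show ?thesis by (simp add: \<nu>_def add_divide_distrib)
    qed
    moreover have "\<bar>\<nu> ((\<lambda>x. x + 1) ` E) - \<nu> E\<bar> \<le> 1 / Suc n" for E
    proof -
      \<comment> \<open>Instead of the set, the window is translated; the two windows differ in their end points.\<close>
      let ?J = "{-1..int n - 1}"
      have "(\<lambda>x. x + 1) ` E \<inter> ?I = (\<lambda>x. x + 1) ` (E \<inter> ?J)"
        by (auto simp: image_iff Bex_def intro: exI[of _ "_ - 1"])
      then have 1: "card ((\<lambda>x. x + 1) ` E \<inter> ?I) = card (E \<inter> ?J)"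
        by (simp add: card_image)
      have "card (E \<inter> ?J) \<le> card (insert (-1) (E \<inter> ?I))"
        by (rule card_mono) auto
      then have 2: "card (E \<inter> ?J) \<le> Suc (card (E \<inter> ?I))"
        by (simp add: card_insert_if split: if_splits)
      have "card (E \<inter> ?I) \<le> card (insert (int n) (E \<inter> ?J))"
        by (rule card_mono) auto
      then have 3: "card (E \<inter> ?I) \<le> Suc (card (E \<inter> ?J))"
        by (simp add: card_insert_if split: if_splits)
      have "\<bar>real (card (E \<inter> ?J)) - card (E \<inter> ?I)\<bar> \<le> 1" using 2 3 by linarith
      then show ?thesis
        unfolding \<nu>_def 1 by (simp add: diff_divide_distrib[symmetric] divide_right_mono)
    qed
    ultimately have "\<nu> \<in> K n" by (simp add: K_def \<nu>_def)
    then show ?thesis by blast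
  qed
  have "K 0 \<inter> (\<Inter>n\<in>UNIV. K n) \<noteq> {}"
  proof (rule compact_imp_fip_image)
    show "K 0 \<inter> (\<Inter>n\<in>I. K n) \<noteq> {}" if "finite I" for I
    proof -
      have "K (Max (insert 0 I)) \<subseteq> K n" if "n \<in> insert 0 I" for n
        using \<open>finite I\<close> that by (intro mono Max_ge) auto
      then have "K (Max (insert 0 I)) \<subseteq> K 0 \<inter> (\<Inter>n\<in>I. K n)"
        by blast
      then show ?thesis using ne by blast
    qed
  qed (use cpt closed in auto)
  then obtain \<nu> where \<nu>: "\<And>n. \<nu> \<in> K n" by auto
  have step: "\<nu> ((\<lambda>x. x + 1) ` E) = \<nu> E" for E
  proof -
    have "\<bar>\<nu> ((\<lambda>x. x + 1) ` E) - \<nu> E\<bar> \<le> 1 / Suc n" for n using \<nu>[of n] by (simp add: K_def)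
    then have "\<bar>\<nu> ((\<lambda>x. x + 1) ` E) - \<nu> E\<bar> \<le> 0"
      by (intro LIMSEQ_le_const[OF LIMSEQ_inverse_real_of_nat]) (auto simp: inverse_eq_divide)
    then show ?thesis by simp
  qed
  have nat: "\<nu> ((\<lambda>x. x + int k) ` E) = \<nu> E" for k E
  proof (induction k)
    case (Suc k)
    have "(\<lambda>x. x + int (Suc k)) ` E = (\<lambda>x. x + 1) ` (\<lambda>x. x + int k) ` E"
      by (simp add: image_image add.commute add.left_commute)
    then show ?case using step Suc by simp
  qed simp
  have "\<nu> ((\<lambda>x. x + g) ` E) = \<nu> E" for g E
  proof (cases "g \<ge> 0")
    case True
    then show ?thesis using nat[of "nat g" E] by simp
  next
    case False
    then show ?thesis using nat[of "nat (-g)" "(\<lambda>x. x + g) ` E"] by (simp add: image_image)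
  qed
  moreover have "g <#\<^bsub>integer_group\<^esub> E = (\<lambda>x. x + g) ` E" for g E
    by (auto simp: l_coset_def add.commute)
  ultimately show ?thesis
    unfolding amenable_group_def using \<nu>[of 0]
    by (intro conjI exI[of _ \<nu>]) (auto simp: K_def)
qed

lemma cyclic_group_amenable:
  assumes "group Q" "cyclic_group Q"
  shows "amenable_group Q"
proof -
  interpret group Q by fact
  obtain x where x: "x \<in> carrier Q" "carrier Q = range (\<lambda>n::int. x [^]\<^bsub>Q\<^esub> n)"
    using assms cyclic_group by blast
  then have "(\<lambda>n::int. x [^]\<^bsub>Q\<^esub> n) \<in> epi integer_group Q"
    by (auto simp: epi_def hom_def int_pow_mult)
  then show ?thesis
    by (rule amenable_groupI_pushforward[OF amenable_integer_group assms(1)])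
qed

section \<open>Preimages of subgroups\<close>

context group_hom
begin

lemma preimage_subgroup:
  assumes U: "subgroup U H"
  shows "subgroup {x \<in> carrier G. h x \<in> U} G"
proof -
  interpret U: subgroup U H by fact
  show ?thesis by unfold_locales auto
qed

lemma epi_preimage:
  assumes "h ` carrier G = carrier H" "subgroup U H"
  shows "h \<in> epi (G\<lparr>carrier := {x \<in> carrier G. h x \<in> U}\<rparr>) (H\<lparr>carrier := U\<rparr>)"
proof -
  have "U \<subseteq> h ` carrier G" using assms subgroup.subset by blast
  then show ?thesis by (auto simp: epi_def hom_def)
qed

lemma kernel_preimage:
  assumes "subgroup U H"
  shows "kernel (G\<lparr>carrier := {x \<in> carrier G. h x \<in> U}\<rparr>) (H\<lparr>carrier := U\<rparr>) h = kernel G H h"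
  using subgroup.one_closed[OF assms] by (auto simp: kernel_def)

end

section \<open>The centralizer of a cyclic normal subgroup\<close>

lemma conjugation_hom:
  assumes "group G" "x \<in> carrier G"
  shows "(\<lambda>y. inv\<^bsub>G\<^esub> x \<otimes>\<^bsub>G\<^esub> y \<otimes>\<^bsub>G\<^esub> x) \<in> hom G G"
proof -
  interpret group G by fact
  show ?thesis using assms(2) by (auto simp: hom_def m_assoc mult_inv_cancel)
qed

text \<open>
  If \<open>A\<close> is finite this is clear.  If \<open>a\<close> has infinite order, let \<open>x\<close> conjugate \<open>a\<close> to \<open>a ^ n\<close> and the
  inverse of \<open>x\<close> conjugate \<open>a\<close> to \<open>a ^ m\<close>.  Then \<open>a = a ^ (n m)\<close>, so \<open>n\<close> is \<open>1\<close> or \<open>-1\<close>.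
\<close>

lemma finite_conjugates_in_cyclic_normal:
  assumes "group G" and A: "A \<lhd> G" and a: "a \<in> A" "A = range (\<lambda>n::int. a [^]\<^bsub>G\<^esub> n)"
  shows "finite ((\<lambda>x. inv\<^bsub>G\<^esub> x \<otimes>\<^bsub>G\<^esub> a \<otimes>\<^bsub>G\<^esub> x) ` carrier G)"
proof -
  interpret group G by fact
  interpret A: normal A G by fact
  have aG: "a \<in> carrier G" using a A.subset by auto
  define conj where "conj x y = inv\<^bsub>G\<^esub> x \<otimes>\<^bsub>G\<^esub> y \<otimes>\<^bsub>G\<^esub> x" for x y
  have conj_A: "conj x y \<in> A" if "x \<in> carrier G" "y \<in> A" for x y
    using that A.inv_op_closed1 by (simp add: conj_def)
  show ?thesis
  proof (cases "ord a = 0")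
    case False
    have "a [^]\<^bsub>G\<^esub> n \<in> (\<lambda>n. a [^]\<^bsub>G\<^esub> n) ` {0..<int (ord a)}" for n :: int
    proof (rule image_eqI)
      have "a [^]\<^bsub>G\<^esub> (int (ord a) * (n div int (ord a))) = \<one>\<^bsub>G\<^esub>"
        using int_pow_eq_id[OF aG] by simp
      then show "a [^]\<^bsub>G\<^esub> n = a [^]\<^bsub>G\<^esub> (n mod int (ord a))"
        using aG int_pow_mult[of a "int (ord a) * (n div int (ord a))" "n mod int (ord a)"] by simp
    qed (use False in simp)
    then have "A \<subseteq> (\<lambda>n. a [^]\<^bsub>G\<^esub> n) ` {0..<int (ord a)}" using a(2) by blast
    then have "finite A" by (rule finite_subset) simp
    moreover have "(\<lambda>x. conj x a) ` carrier G \<subseteq> A" using conj_A a(1) by (intro image_subsetI)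
    ultimately have "finite ((\<lambda>x. conj x a) ` carrier G)" by (rule finite_subset[rotated])
    then show ?thesis by (simp only: conj_def)
  next
    case True
    have "conj x a \<in> {a, inv\<^bsub>G\<^esub> a}" if x: "x \<in> carrier G" for x
    proof -
      obtain n :: int where n: "conj x a = a [^]\<^bsub>G\<^esub> n" using conj_A[OF x a(1)] a(2) by blast
      have "conj (inv\<^bsub>G\<^esub> x) a \<in> A" using conj_A[of "inv\<^bsub>G\<^esub> x"] x a(1) by simp
      then obtain m :: int where m: "conj (inv\<^bsub>G\<^esub> x) a = a [^]\<^bsub>G\<^esub> m" using a(2) by blast
      have hom: "conj x \<in> hom G G"
        using conjugation_hom[OF assms(1) x] by (simp add: conj_def[abs_def])
      have "a = conj x (conj (inv\<^bsub>G\<^esub> x) a)"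
        using x aG by (simp add: conj_def m_assoc inv_mult_cancel)
      also have "\<dots> = (a [^]\<^bsub>G\<^esub> n) [^]\<^bsub>G\<^esub> m"
        unfolding m using hom_int_pow[OF hom aG] assms(1) n by simp
      also have "\<dots> = a [^]\<^bsub>G\<^esub> (n * m)"
        using aG by (simp add: int_pow_pow)
      finally have "a [^]\<^bsub>G\<^esub> (n * m - 1) = \<one>\<^bsub>G\<^esub>"
        using aG by (simp add: int_pow_diff)
      then have "n * m = 1"
        using int_pow_eq_id[OF aG, of "n * m - 1"] True by simp
      then have "n = 1 \<or> n = -1" using zmult_eq_1_iff by blast
      then show ?thesis using n aG by (auto simp: int_pow_neg)
    qed
    then have "(\<lambda>x. conj x a) ` carrier G \<subseteq> {a, inv\<^bsub>G\<^esub> a}" by (rule image_subsetI)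
    then have "finite ((\<lambda>x. conj x a) ` carrier G)" by (rule finite_subset) simp
    then show ?thesis by (simp only: conj_def)
  qed
qed

definition centralizer :: "'a monoid \<Rightarrow> 'a set \<Rightarrow> 'a set" where
  "centralizer G A = {x \<in> carrier G. \<forall>y \<in> A. x \<otimes>\<^bsub>G\<^esub> y = y \<otimes>\<^bsub>G\<^esub> x}"

lemma centralizer_normal:
  assumes "group G" "A \<lhd> G"
  shows "centralizer G A \<lhd> G"
proof -
  interpret group G by fact
  interpret A: normal A G by fact
  have inv_comm: "inv\<^bsub>G\<^esub> x \<otimes>\<^bsub>G\<^esub> y = y \<otimes>\<^bsub>G\<^esub> inv\<^bsub>G\<^esub> x"
    if "x \<in> carrier G" "y \<in> carrier G" "x \<otimes>\<^bsub>G\<^esub> y = y \<otimes>\<^bsub>G\<^esub> x" for x y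
  proof -
    have "y \<otimes>\<^bsub>G\<^esub> inv\<^bsub>G\<^esub> x = inv\<^bsub>G\<^esub> x \<otimes>\<^bsub>G\<^esub> (x \<otimes>\<^bsub>G\<^esub> y) \<otimes>\<^bsub>G\<^esub> inv\<^bsub>G\<^esub> x"
      using that(1,2) by (simp add: m_assoc[symmetric])
    also have "\<dots> = inv\<^bsub>G\<^esub> x \<otimes>\<^bsub>G\<^esub> y"
      unfolding that(3) using that(1,2) by (simp add: m_assoc)
    finally show ?thesis by simp
  qed
  have sub: "subgroup (centralizer G A) G"
  proof
    fix x y assume xy: "x \<in> centralizer G A" "y \<in> centralizer G A"
    show "x \<otimes>\<^bsub>G\<^esub> y \<in> centralizer G A"
      unfolding centralizer_def
    proof (intro CollectI conjI ballI)
      fix z assume z: "z \<in> A"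
      have "x \<otimes>\<^bsub>G\<^esub> y \<otimes>\<^bsub>G\<^esub> z = x \<otimes>\<^bsub>G\<^esub> (z \<otimes>\<^bsub>G\<^esub> y)"
        using xy z A.subset by (auto simp: centralizer_def m_assoc)
      also have "\<dots> = z \<otimes>\<^bsub>G\<^esub> x \<otimes>\<^bsub>G\<^esub> y"
        using xy z A.subset by (auto simp: centralizer_def m_assoc[symmetric])
      finally show "x \<otimes>\<^bsub>G\<^esub> y \<otimes>\<^bsub>G\<^esub> z = z \<otimes>\<^bsub>G\<^esub> (x \<otimes>\<^bsub>G\<^esub> y)"
        using xy z A.subset by (auto simp: centralizer_def m_assoc)
    qed (use xy in \<open>auto simp: centralizer_def\<close>)
    show "inv\<^bsub>G\<^esub> x \<in> centralizer G A"
      using xy A.subset by (auto simp: centralizer_def inv_comm)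
  qed (use A.subset in \<open>auto simp: centralizer_def\<close>)
  have "x \<otimes>\<^bsub>G\<^esub> c \<otimes>\<^bsub>G\<^esub> inv\<^bsub>G\<^esub> x \<in> centralizer G A"
    if x: "x \<in> carrier G" and c: "c \<in> centralizer G A" for x c
    unfolding centralizer_def
  proof (intro CollectI conjI ballI)
    have cG: "c \<in> carrier G" using c by (simp add: centralizer_def)
    then show "x \<otimes>\<^bsub>G\<^esub> c \<otimes>\<^bsub>G\<^esub> inv\<^bsub>G\<^esub> x \<in> carrier G" using x by simp
    fix y assume y: "y \<in> A"
    define z where "z = inv\<^bsub>G\<^esub> x \<otimes>\<^bsub>G\<^esub> y \<otimes>\<^bsub>G\<^esub> x"
    have z: "z \<in> A" "z \<in> carrier G" using A.inv_op_closed1[OF x y] A.subset by (auto simp: z_def)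
    have yG: "y \<in> carrier G" using y A.subset by auto
    have yx: "y \<otimes>\<^bsub>G\<^esub> x = x \<otimes>\<^bsub>G\<^esub> z"
      using x yG by (simp add: z_def m_assoc[symmetric])
    have xy: "inv\<^bsub>G\<^esub> x \<otimes>\<^bsub>G\<^esub> y = z \<otimes>\<^bsub>G\<^esub> inv\<^bsub>G\<^esub> x"
      using x yG by (simp add: z_def m_assoc)
    have cz: "c \<otimes>\<^bsub>G\<^esub> z = z \<otimes>\<^bsub>G\<^esub> c" using c z by (simp add: centralizer_def)
    have "x \<otimes>\<^bsub>G\<^esub> c \<otimes>\<^bsub>G\<^esub> inv\<^bsub>G\<^esub> x \<otimes>\<^bsub>G\<^esub> y = x \<otimes>\<^bsub>G\<^esub> (c \<otimes>\<^bsub>G\<^esub> z) \<otimes>\<^bsub>G\<^esub> inv\<^bsub>G\<^esub> x"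
      using x cG yG z by (simp add: m_assoc xy)
    also have "\<dots> = (x \<otimes>\<^bsub>G\<^esub> z) \<otimes>\<^bsub>G\<^esub> c \<otimes>\<^bsub>G\<^esub> inv\<^bsub>G\<^esub> x"
      unfolding cz using x cG z by (simp add: m_assoc)
    also have "\<dots> = y \<otimes>\<^bsub>G\<^esub> (x \<otimes>\<^bsub>G\<^esub> c \<otimes>\<^bsub>G\<^esub> inv\<^bsub>G\<^esub> x)"
      unfolding yx[symmetric] using x cG yG by (simp add: m_assoc)
    finally show "x \<otimes>\<^bsub>G\<^esub> c \<otimes>\<^bsub>G\<^esub> inv\<^bsub>G\<^esub> x \<otimes>\<^bsub>G\<^esub> y = y \<otimes>\<^bsub>G\<^esub> (x \<otimes>\<^bsub>G\<^esub> c \<otimes>\<^bsub>G\<^esub> inv\<^bsub>G\<^esub> x)" .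
  qed
  then show ?thesis using sub by (auto simp: normal_inv_iff)
qed

text \<open>
  An element centralizes \<open>A\<close> as soon as it commutes with the generator \<open>a\<close>.  Hence the coset of \<open>x\<close>
  modulo the centralizer is determined by the conjugate of \<open>a\<close> by \<open>x\<close>, and there are only finitely
  many such conjugates.
\<close>

lemma finite_FactGroup_centralizer_cyclic:
  assumes "group G" and A: "A \<lhd> G" and a: "a \<in> A" "A = range (\<lambda>n::int. a [^]\<^bsub>G\<^esub> n)"
  shows "finite (carrier (G Mod centralizer G A))"
proof -
  interpret group G by fact
  interpret A: normal A G by fact
  interpret C: normal "centralizer G A" G by (rule centralizer_normal) fact+
  have aG: "a \<in> carrier G" using a A.subset by auto
  define conj where "conj x = inv\<^bsub>G\<^esub> x \<otimes>\<^bsub>G\<^esub> a \<otimes>\<^bsub>G\<^esub> x" for x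
  let ?coset = "\<lambda>x. centralizer G A #>\<^bsub>G\<^esub> x"
  have coset: "?coset x = ?coset y"
    if x: "x \<in> carrier G" and y: "y \<in> carrier G" and eq: "conj x = conj y" for x y
  proof -
    define c where "c = x \<otimes>\<^bsub>G\<^esub> inv\<^bsub>G\<^esub> y"
    have cG: "c \<in> carrier G" using x y by (simp add: c_def)
    have "a \<otimes>\<^bsub>G\<^esub> c = x \<otimes>\<^bsub>G\<^esub> conj x \<otimes>\<^bsub>G\<^esub> inv\<^bsub>G\<^esub> y"
      using x y aG by (simp add: conj_def c_def m_assoc[symmetric])
    also have "\<dots> = c \<otimes>\<^bsub>G\<^esub> a"
      unfolding eq using x y aG by (simp add: conj_def c_def m_assoc)
    finally have "inv\<^bsub>G\<^esub> c \<otimes>\<^bsub>G\<^esub> a \<otimes>\<^bsub>G\<^esub> c = a"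
      using aG cG by (simp add: m_assoc inv_mult_cancel)
    then have fix_pow: "inv\<^bsub>G\<^esub> c \<otimes>\<^bsub>G\<^esub> a [^]\<^bsub>G\<^esub> n \<otimes>\<^bsub>G\<^esub> c = a [^]\<^bsub>G\<^esub> n" for n :: int
      using hom_int_pow[OF conjugation_hom[OF assms(1) cG] aG] assms(1) by simp
    have "c \<otimes>\<^bsub>G\<^esub> a [^]\<^bsub>G\<^esub> n = c \<otimes>\<^bsub>G\<^esub> (inv\<^bsub>G\<^esub> c \<otimes>\<^bsub>G\<^esub> a [^]\<^bsub>G\<^esub> n \<otimes>\<^bsub>G\<^esub> c)" for n :: int
      unfolding fix_pow ..
    then have comm: "c \<otimes>\<^bsub>G\<^esub> a [^]\<^bsub>G\<^esub> n = a [^]\<^bsub>G\<^esub> n \<otimes>\<^bsub>G\<^esub> c" for n :: int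
      using aG cG by (simp add: m_assoc mult_inv_cancel)
    have "c \<otimes>\<^bsub>G\<^esub> y = y \<otimes>\<^bsub>G\<^esub> c" if y: "y \<in> A" for y
    proof -
      obtain n :: int where "y = a [^]\<^bsub>G\<^esub> n" using y unfolding a(2) by (rule rangeE)
      then show ?thesis using comm by simp
    qed
    then have "c \<in> centralizer G A" using cG unfolding centralizer_def by blast
    then have "?coset c = centralizer G A" by (rule coset_join2[OF cG C.subgroup_axioms])
    then show ?thesis
      unfolding c_def using x y C.subset by (rule coset_mult_inv1)
  qed
  have "?coset ` carrier G \<subseteq> (\<lambda>z. ?coset (inv_into (carrier G) conj z)) ` conj ` carrier G"
  proof
    fix Z assume "Z \<in> ?coset ` carrier G"
    then obtain x where x: "x \<in> carrier G" "Z = ?coset x" by blast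
    let ?y = "inv_into (carrier G) conj (conj x)"
    have "?y \<in> carrier G" "conj ?y = conj x"
      using x(1) by (simp_all only: inv_into_into f_inv_into_f imageI)
    then have "Z = ?coset ?y" using coset[OF x(1), of ?y] x(2) by simp
    then show "Z \<in> (\<lambda>z. ?coset (inv_into (carrier G) conj z)) ` conj ` carrier G"
      by (rule image_eqI) (use x(1) in blast)
  qed
  moreover have "finite (conj ` carrier G)"
    using finite_conjugates_in_cyclic_normal[OF assms] by (simp add: conj_def[abs_def])
  then have "finite ((\<lambda>z. ?coset (inv_into (carrier G) conj z)) ` conj ` carrier G)"
    by (rule finite_imageI)
  ultimately show ?thesis
    unfolding carrier_FactGroup by (rule finite_subset)
qed

section \<open>Extensions with cyclic kernel\<close>

lemma amenable_FactGroup_kernel: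
  assumes "group_hom G H h" and "h ` carrier G = carrier H" and "amenable_group H"
  shows "amenable_group (G Mod kernel G H h)"
proof -
  interpret group_hom G H h by fact
  have grp: "group (G Mod kernel G H h)"
    by (rule normal.factorgroup_is_group[OF normal_kernel])
  have "inv_into (carrier (G Mod kernel G H h)) (\<lambda>c. the_elem (h ` c)) \<in> iso H (G Mod kernel G H h)"
    by (rule group.iso_set_sym[OF grp FactGroup_iso_set[OF assms(2)]])
  then show ?thesis
    unfolding iso_iff_mon_epi by (elim conjE) (rule amenable_groupI_pushforward[OF assms(3) grp])
qed

lemma cyclic_subgroup_generator:
  assumes "group G" "subgroup A G" "cyclic_group (G\<lparr>carrier := A\<rparr>)"
  obtains a where "a \<in> A" "A = range (\<lambda>n::int. a [^]\<^bsub>G\<^esub> n)"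
proof -
  interpret group G by fact
  have grpA: "group (G\<lparr>carrier := A\<rparr>)" by (rule subgroup_imp_group) fact
  obtain a where a: "a \<in> carrier (G\<lparr>carrier := A\<rparr>)"
    "carrier (G\<lparr>carrier := A\<rparr>) = range (\<lambda>n::int. a [^]\<^bsub>G\<lparr>carrier := A\<rparr>\<^esub> n)"
    using assms(3) unfolding group.cyclic_group[OF grpA] by (elim bexE) (rule that)
  then have "a \<in> A" by simp
  moreover have "A = range (\<lambda>n::int. a [^]\<^bsub>G\<^esub> n)"
    using a(2) unfolding int_pow_consistent[OF assms(2) \<open>a \<in> A\<close>] by simp
  ultimately show thesis by (rule that)
qed

text \<open>
  Choose a preimage of each basis element.  A relation between these preimages would map to a
  relation between the basis elements, so they freely generate a subgroup, which maps onto \<open>F\<close>.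
\<close>

lemma free_quotient_lifts:
  assumes "group G" and F: "free_group F" and p: "p \<in> epi G F"
  obtains E where "subgroup E G" "free_group (G\<lparr>carrier := E\<rparr>)"
    "p ` E = carrier F"
proof -
  interpret G: group G by fact
  interpret WG: word_group G by unfold_locales
  obtain S where grpF: "group F" and S: "S \<subseteq> carrier F"
    and inj: "inj_on (word_value F) (reduced_words S)"
    and onto: "word_value F ` reduced_words S = carrier F"
    using F by (auto simp: free_group_def bij_betw_def)
  interpret F: group F by fact
  interpret WF: word_group F by unfold_locales
  have p_onto: "p ` carrier G = carrier F" and hom: "p \<in> hom G F" using p by (auto simp: epi_def)
  interpret p: group_hom G F p by unfold_locales (rule hom)
  define lift where "lift = inv_into (carrier G) p"
  have lift: "lift s \<in> carrier G" "p (lift s) = s" if "s \<in> S" for s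
  proof -
    have "s \<in> p ` carrier G" using that S p_onto by auto
    then show "lift s \<in> carrier G" "p (lift s) = s"
      unfolding lift_def by (rule inv_into_into, rule f_inv_into_f)
  qed
  define B where "B = lift ` S"
  have B: "B \<subseteq> carrier G" using lift by (auto simp: B_def)
  have pX: "p ` B = S" using lift by (force simp: B_def)
  have inj_p: "inj_on p B" using lift by (auto simp: B_def intro!: inj_onI)
  \<comment> \<open>The map that \<open>p\<close> induces on letters.\<close>
  define q where "q = (\<lambda>(x, b :: bool). (p x, b))"
  have q_letters: "q l \<in> S \<times> UNIV" if "l \<in> B \<times> UNIV" for l
    using that pX by (auto simp: q_def)
  have inj_q: "inj_on q (B \<times> UNIV)"
    using inj_p by (auto simp: q_def inj_on_def)
  have q_inv: "q (inv_letter l) = inv_letter (q l)" for l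
    by (simp add: q_def inv_letter_def case_prod_unfold)
  have q_reduced: "map q w \<in> reduced_words S" if w: "w \<in> reduced_words B" for w
  proof -
    have "successively (\<lambda>l m. m \<noteq> inv_letter l) (map q w)"
      unfolding successively_map
    proof (rule successively_mono)
      show "successively (\<lambda>l m. m \<noteq> inv_letter l) w" using w by (simp add: reduced_words_eq)
      fix l m assume "l \<in> set w" "m \<in> set w" "m \<noteq> inv_letter l"
      moreover then have "l \<in> B \<times> UNIV" "m \<in> B \<times> UNIV"
        using w by (auto simp: reduced_words_eq)
      ultimately show "q m \<noteq> inv_letter (q l)"
        unfolding q_inv[symmetric] using inj_onD[OF inj_q, of m "inv_letter l"] by auto
    qed
    then show ?thesis
      using w q_letters by (auto simp: reduced_words_eq in_lists_conv_set)
  qed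
  have p_value: "p (word_value G w) = word_value F (map q w)" if "w \<in> lists (B \<times> UNIV)" for w
    using that
  proof (induction w)
    case (Cons l w)
    then have w: "w \<in> lists (B \<times> UNIV)" and l: "l \<in> B \<times> UNIV" by auto
    have IH: "p (word_value G w) = word_value F (map q w)" using Cons w by blast
    have "p (letter_value G l) = letter_value F (q l)"
      using l B by (auto simp: letter_value_def q_def)
    then show ?case
      using IH WG.word_value_closed[OF B w] WG.letter_value_closed[OF B l] by simp
  qed simp
  have eq_words: "u = v" if u: "u \<in> reduced_words B" and v: "v \<in> reduced_words B"
    and eq: "word_value G u = word_value G v" for u v
  proof -
    have "word_value F (map q u) = word_value F (map q v)"
      using arg_cong[OF eq, of p]
      by (simp add: p_value reduced_words_lists[OF u] reduced_words_lists[OF v])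
    then have "map q u = map q v"
      using inj_onD[OF inj] q_reduced[OF u] q_reduced[OF v] by blast
    moreover have "set u \<union> set v \<subseteq> B \<times> UNIV"
      using reduced_words_lists[OF u] reduced_words_lists[OF v] by auto
    then have "inj_on q (set u \<union> set v)" by (rule inj_on_subset[OF inj_q])
    ultimately show ?thesis using inj_on_map_eq_map by blast
  qed
  then have inj_X: "inj_on (word_value G) (reduced_words B)" by (auto intro: inj_onI)
  show thesis
  proof (rule that[of "generate G B"])
    show "subgroup (generate G B) G" by (rule G.generate_is_subgroup[OF B])
    show "free_group (G\<lparr>carrier := generate G B\<rparr>)"
      by (rule WG.free_group_generate[OF B inj_X])
    show "p ` generate G B = carrier F"
      using p.generate_img[OF B] onto WF.generate_eq_reduced_words[OF S] by (simp add: pX)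
  qed
qed

text \<open>
  Inside \<open>G\<close> there is the chain \<open>L \<le> C \<le> G\<close>, where \<open>L\<close> is free, \<open>C / L\<close> is cyclic and \<open>G / C\<close> is
  finite; two extensions with amenable quotient lead from \<open>L\<close> to \<open>G\<close>.
\<close>

lemma class_K_cyclic_by_free:
  assumes grp: "group G" and F: "free_group F" and p: "p \<in> epi G F"
    and cyc: "cyclic_group (G\<lparr>carrier := kernel G F p\<rparr>)"
  shows "class_K G"
proof -
  interpret group G by fact
  interpret F: group F using F by (simp add: free_group_def)
  have hom: "p \<in> hom G F" using p by (auto simp: epi_def)
  interpret p: group_hom G F p by unfold_locales (rule hom)
  define A where "A = kernel G F p"
  have A: "A \<lhd> G" unfolding A_def by (rule p.normal_kernel)
  interpret A: normal A G by (rule A)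
  have cyc: "cyclic_group (G\<lparr>carrier := A\<rparr>)" using cyc by (simp add: A_def)
  obtain a where a: "a \<in> A" "A = range (\<lambda>n::int. a [^]\<^bsub>G\<^esub> n)"
    using cyclic_subgroup_generator[OF grp A.subgroup_axioms cyc] .
  define C where "C = centralizer G A"
  have C: "C \<lhd> G" unfolding C_def by (rule centralizer_normal[OF grp A])
  interpret C: normal C G by (rule C)
  have fin: "finite (carrier (G Mod C))"
    unfolding C_def by (rule finite_FactGroup_centralizer_cyclic[OF grp A a])
  have grpA: "group (G\<lparr>carrier := A\<rparr>)" by (rule subgroup_imp_group[OF A.subgroup_axioms])
  have grpC: "group (G\<lparr>carrier := C\<rparr>)" by (rule subgroup_imp_group[OF C.subgroup_axioms])
  have "comm_group (G\<lparr>carrier := A\<rparr>)" by (rule group.cyclic_imp_abelian_group[OF grpA cyc])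
  then have "x \<otimes>\<^bsub>G\<^esub> y = y \<otimes>\<^bsub>G\<^esub> x" if "x \<in> A" "y \<in> A" for x y
    using comm_monoid.m_comm[of "G\<lparr>carrier := A\<rparr>" x y] that by (simp add: comm_group_def)
  \<comment> \<open>A cyclic group is abelian, so it lies in its own centralizer.\<close>
  then have AC: "A \<subseteq> C" using A.subset unfolding C_def centralizer_def by blast
  have comm: "c \<otimes>\<^bsub>G\<^esub> y = y \<otimes>\<^bsub>G\<^esub> c" if "c \<in> C" "y \<in> A" for c y
    using that unfolding C_def centralizer_def by blast
  obtain E where E: "subgroup E G" "free_group (G\<lparr>carrier := E\<rparr>)"
    and pE: "p ` E = carrier F"
    using free_quotient_lifts[OF grp F p] .
  interpret E: subgroup E G by (rule E)
  define L where "L = C \<inter> E"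
  have L: "subgroup L G" unfolding L_def by (rule subgroups_Inter_pair[OF C.subgroup_axioms E(1)])
  interpret L: subgroup L G by (rule L)
  have "subgroup L (G\<lparr>carrier := E\<rparr>)" by (rule subgroup_incl[OF L E(1)]) (simp add: L_def)
  then have "free_group (G\<lparr>carrier := L\<rparr>)" using nielsen_schreier[OF E(2)] by simp
  then have KL: "class_K (G\<lparr>carrier := C\<rparr>\<lparr>carrier := L\<rparr>)" using class_K.free by simp
  \<comment> \<open>The decomposition of \<open>C\<close> as \<open>L A\<close>: correct \<open>x\<close> by an element of \<open>E\<close> with the same image under \<open>p\<close>.\<close>
  have decomp: "\<exists>e \<in> L. \<exists>y \<in> A. x = e \<otimes>\<^bsub>G\<^esub> y" if x: "x \<in> C" for x
  proof -
    have xG: "x \<in> carrier G" using x C.subset by auto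
    then have "p x \<in> p ` E" by (simp add: pE)
    then obtain e where e: "e \<in> E" "p e = p x" by auto
    have eG: "e \<in> carrier G" using e E.subset by auto
    define y where "y = inv\<^bsub>G\<^esub> e \<otimes>\<^bsub>G\<^esub> x"
    have "inv\<^bsub>G\<^esub> e \<otimes>\<^bsub>G\<^esub> x \<in> kernel G F p" using e(2) xG eG unfolding kernel_def by simp
    then have y: "y \<in> A" unfolding y_def A_def .
    then have yG: "y \<in> carrier G" "y \<in> C" using AC C.subset by auto
    have xey: "x = e \<otimes>\<^bsub>G\<^esub> y" using xG eG by (simp add: y_def mult_inv_cancel)
    then have "e \<in> C"
      using mult_mem_subgroup_iff[OF C.subgroup_axioms eG yG(2)] x by simp
    then show ?thesis using e y xey by (auto simp: L_def)
  qed
  have L_normal: "L \<lhd> (G\<lparr>carrier := C\<rparr>)"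
  proof -
    have "x \<otimes>\<^bsub>G\<^esub> h \<otimes>\<^bsub>G\<^esub> inv\<^bsub>G\<^esub> x \<in> L" if x: "x \<in> C" and h: "h \<in> L" for x h
    proof -
      obtain e y where ey: "e \<in> L" "y \<in> A" "x = e \<otimes>\<^bsub>G\<^esub> y" using decomp[OF x] by auto
      have closed: "e \<in> carrier G" "y \<in> carrier G" "h \<in> carrier G"
        using ey h L.subset A.subset by auto
      have "h \<otimes>\<^bsub>G\<^esub> y = y \<otimes>\<^bsub>G\<^esub> h" using h ey(2) by (intro comm) (simp_all add: L_def)
      then have "x \<otimes>\<^bsub>G\<^esub> h = e \<otimes>\<^bsub>G\<^esub> h \<otimes>\<^bsub>G\<^esub> y" using closed by (simp add: ey(3) m_assoc)
      then have "x \<otimes>\<^bsub>G\<^esub> h \<otimes>\<^bsub>G\<^esub> inv\<^bsub>G\<^esub> x = e \<otimes>\<^bsub>G\<^esub> h \<otimes>\<^bsub>G\<^esub> inv\<^bsub>G\<^esub> e"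
        using closed by (simp add: ey(3) group_word_simps)
      then show ?thesis using ey(1) h by simp
    qed
    moreover have "subgroup L (G\<lparr>carrier := C\<rparr>)"
      by (rule subgroup_incl[OF L C.subgroup_axioms]) (simp add: L_def)
    ultimately show ?thesis
      using m_inv_consistent[OF C.subgroup_axioms] by (simp add: group.normal_inv_iff[OF grpC])
  qed
  interpret LC: normal L "G\<lparr>carrier := C\<rparr>" by (rule L_normal)
  let ?Q = "G\<lparr>carrier := C\<rparr> Mod L"
  have grpQ: "group ?Q" by (rule LC.factorgroup_is_group)
  \<comment> \<open>Since \<open>C = L A\<close>, every coset of \<open>L\<close> in \<open>C\<close> has a representative in \<open>A\<close>.\<close>
  have "(\<lambda>y. L #>\<^bsub>G\<lparr>carrier := C\<rparr>\<^esub> y) \<in> epi (G\<lparr>carrier := A\<rparr>) ?Q"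
  proof -
    have "carrier ?Q \<subseteq> (\<lambda>y. L #>\<^bsub>G\<lparr>carrier := C\<rparr>\<^esub> y) ` A"
    proof
      fix Z assume "Z \<in> carrier ?Q"
      then obtain x where x: "x \<in> C" "Z = L #>\<^bsub>G\<lparr>carrier := C\<rparr>\<^esub> x"
        by (auto simp: carrier_FactGroup)
      obtain e y where ey: "e \<in> L" "y \<in> A" "x = e \<otimes>\<^bsub>G\<^esub> y" using decomp[OF x(1)] by auto
      have "x \<in> L #>\<^bsub>G\<lparr>carrier := C\<rparr>\<^esub> y" using ey by (auto simp: r_coset_def)
      then have "L #>\<^bsub>G\<lparr>carrier := C\<rparr>\<^esub> y = L #>\<^bsub>G\<lparr>carrier := C\<rparr>\<^esub> x"
        using LC.repr_independence LC.subgroup_axioms ey(2) AC by auto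
      then show "Z \<in> (\<lambda>y. L #>\<^bsub>G\<lparr>carrier := C\<rparr>\<^esub> y) ` A" using x(2) ey(2) by auto
    qed
    moreover have "(\<lambda>y. L #>\<^bsub>G\<lparr>carrier := C\<rparr>\<^esub> y) \<in> hom (G\<lparr>carrier := A\<rparr>) ?Q"
    proof (rule homI)
      fix x y assume xy: "x \<in> carrier (G\<lparr>carrier := A\<rparr>)" "y \<in> carrier (G\<lparr>carrier := A\<rparr>)"
      then have "x \<in> carrier (G\<lparr>carrier := C\<rparr>)" "y \<in> carrier (G\<lparr>carrier := C\<rparr>)"
        using AC by auto
      from hom_in_carrier[OF LC.r_coset_hom_Mod this(1)] hom_mult[OF LC.r_coset_hom_Mod this]
      show "L #>\<^bsub>G\<lparr>carrier := C\<rparr>\<^esub> x \<in> carrier ?Q"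
        "L #>\<^bsub>G\<lparr>carrier := C\<rparr>\<^esub> (x \<otimes>\<^bsub>G\<lparr>carrier := A\<rparr>\<^esub> y) =
          (L #>\<^bsub>G\<lparr>carrier := C\<rparr>\<^esub> x) \<otimes>\<^bsub>?Q\<^esub> (L #>\<^bsub>G\<lparr>carrier := C\<rparr>\<^esub> y)"
        by simp_all
    qed
    ultimately show ?thesis by (simp add: epi_iff_subset)
  qed
  then have "cyclic_group ?Q"
    by (rule group.cyclic_group_epimorphic_image[OF grpA _ cyc grpQ])
  then have "amenable_group ?Q" by (rule cyclic_group_amenable[OF grpQ])
  then have KC: "class_K (G\<lparr>carrier := C\<rparr>)" by (rule class_K.extension[OF L_normal KL])
  have "amenable_group (G Mod C)"
    by (rule finite_group_amenable[OF C.factorgroup_is_group fin])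
  then show ?thesis by (rule class_K.extension[OF C KC])
qed

text \<open>
  Induction on the derivation of \<open>H \<in> \<K>\<close> for all groups \<open>G\<close> over \<open>H\<close> at once.  The kernel is kept as
  a subgroup of \<open>G\<close>, because passing to the preimage of a subgroup of \<open>H\<close> leaves it unchanged.
\<close>

lemma class_K_cyclic_kernel:
  fixes G :: "'b monoid" and H :: "'c monoid"
  assumes "class_K H" "group G" "p \<in> epi G H" "cyclic_group (G\<lparr>carrier := kernel G H p\<rparr>)"
  shows "class_K G"
  using assms
proof (induction arbitrary: G rule: class_K.induct)
  case (free F)
  show ?case by (rule class_K_cyclic_by_free[OF free(2,1,3,4)])
next
  case (amenable H)
  have onto: "p ` carrier G = carrier H" and hom: "p \<in> hom G H" using amenable(3) by (auto simp: epi_def)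
  have p: "group_hom G H p"
    using amenable(1,2) hom by (simp add: group_hom_def group_hom_axioms_def amenable_group_def)
  then interpret group_hom G H p .
  have "amenable_group (G\<lparr>carrier := kernel G H p\<rparr>)"
    by (rule cyclic_group_amenable[OF G.subgroup_imp_group[OF subgroup_kernel] amenable(4)])
  then show ?case
    by (rule class_K.extension[OF normal_kernel class_K.amenable])
      (rule amenable_FactGroup_kernel[OF p onto amenable(1)])
next
  case (extension N H)
  interpret N: normal N H by (rule extension(1))
  have onto: "p ` carrier G = carrier H" and hom: "p \<in> hom G H" using extension(6) by (auto simp: epi_def)
  have "group_hom G H p"
    using extension(5) hom by (simp add: group_hom_def group_hom_axioms_def N.is_group)
  then interpret p: group_hom G H p .
  define M where "M = {x \<in> carrier G. p x \<in> N}"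
  have KM: "class_K (G\<lparr>carrier := M\<rparr>)"
  proof (rule extension.IH)
    show "group (G\<lparr>carrier := M\<rparr>)"
      unfolding M_def by (rule p.G.subgroup_imp_group[OF p.preimage_subgroup[OF N.subgroup_axioms]])
    show "p \<in> epi (G\<lparr>carrier := M\<rparr>) (H\<lparr>carrier := N\<rparr>)"
      unfolding M_def by (rule p.epi_preimage[OF onto N.subgroup_axioms])
    show "cyclic_group (G\<lparr>carrier := M\<rparr>\<lparr>carrier := kernel (G\<lparr>carrier := M\<rparr>) (H\<lparr>carrier := N\<rparr>) p\<rparr>)"
      using extension(7) by (simp add: M_def p.kernel_preimage[OF N.subgroup_axioms])
  qed
  have M: "M \<lhd> G" "amenable_group (G Mod M)"
  proof -
    \<comment> \<open>The preimage \<open>M\<close> of \<open>N\<close> is the kernel of the composition of \<open>p\<close> with the projection to \<open>H / N\<close>.\<close>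
    define q where "q = (\<lambda>y. N #>\<^bsub>H\<^esub> y) \<circ> p"
    have "q \<in> hom G (H Mod N)" unfolding q_def by (rule hom_compose[OF hom N.r_coset_hom_Mod])
    then have q: "group_hom G (H Mod N) q"
      using extension(5) N.factorgroup_is_group by (simp add: group_hom_def group_hom_axioms_def)
    then interpret q: group_hom G "H Mod N" q .
    have q_onto: "q ` carrier G = carrier (H Mod N)"
      unfolding q_def image_comp[symmetric] onto carrier_FactGroup ..
    have "N #>\<^bsub>H\<^esub> y = N \<longleftrightarrow> y \<in> N" if "y \<in> carrier H" for y
      using N.coset_join1[OF _ that N.subgroup_axioms] N.coset_join2[OF that N.subgroup_axioms]
      by (rule iffI)
    then have "q x = \<one>\<^bsub>H Mod N\<^esub> \<longleftrightarrow> p x \<in> N" if "x \<in> carrier G" for x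
      using that by (simp add: q_def)
    then have "kernel G (H Mod N) q = M"
      by (simp add: kernel_def M_def cong: conj_cong)
    then show "M \<lhd> G" "amenable_group (G Mod M)"
      using q.normal_kernel amenable_FactGroup_kernel[OF q q_onto extension(3)] by simp_all
  qed
  show ?case by (rule class_K.extension[OF M(1) KM M(2)])
next
  case (directed_union H \<F>)
  have onto: "p ` carrier G = carrier H" and hom: "p \<in> hom G H" using directed_union.prems(2) by (auto simp: epi_def)
  have "group_hom G H p"
    using directed_union.hyps(1) directed_union.prems(1) hom by (simp add: group_hom_def group_hom_axioms_def)
  then interpret p: group_hom G H p .
  define M where "M U = {x \<in> carrier G. p x \<in> U}" for U
  have M: "subgroup (M U) G \<and> class_K (G\<lparr>carrier := M U\<rparr>)" if U: "U \<in> \<F>" for U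
  proof -
    have sub: "subgroup U H" using directed_union.IH U by blast
    have subM: "subgroup (M U) G" unfolding M_def by (rule p.preimage_subgroup[OF sub])
    have "class_K (G\<lparr>carrier := M U\<rparr>)"
    proof (rule directed_union.IH[rule_format, OF U, THEN conjunct2, THEN conjunct2, rule_format])
      show "group (G\<lparr>carrier := M U\<rparr>)" by (rule p.G.subgroup_imp_group[OF subM])
      show "p \<in> epi (G\<lparr>carrier := M U\<rparr>) (H\<lparr>carrier := U\<rparr>)"
        unfolding M_def by (rule p.epi_preimage[OF onto sub])
      show "cyclic_group (G\<lparr>carrier := M U\<rparr>\<lparr>carrier := kernel (G\<lparr>carrier := M U\<rparr>) (H\<lparr>carrier := U\<rparr>) p\<rparr>)"
        using directed_union.prems(3) by (simp add: M_def p.kernel_preimage[OF sub])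
    qed
    then show ?thesis using subM by blast
  qed
  show ?case
  proof (rule class_K.directed_union[of _ "M ` \<F>"])
    show "group G" by (rule directed_union.prems(1))
    show "M ` \<F> \<noteq> {}" using directed_union.hyps(2) by simp
    show "\<forall>U \<in> M ` \<F>. subgroup U G \<and> class_K (G\<lparr>carrier := U\<rparr>)" using M by blast
    show "\<forall>U \<in> M ` \<F>. \<forall>V \<in> M ` \<F>. \<exists>W \<in> M ` \<F>. U \<subseteq> W \<and> V \<subseteq> W"
    proof (intro ballI)
      fix U V assume "U \<in> M ` \<F>" "V \<in> M ` \<F>"
      then obtain U' V' where UV: "U' \<in> \<F>" "V' \<in> \<F>" "U = M U'" "V = M V'" by blast
      then obtain W where "W \<in> \<F>" "U' \<subseteq> W" "V' \<subseteq> W" using directed_union.hyps(3) by blast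
      then show "\<exists>W \<in> M ` \<F>. U \<subseteq> W \<and> V \<subseteq> W"
        using UV by (intro bexI[of _ "M W"]) (auto simp: M_def)
    qed
    have "\<exists>U \<in> \<F>. p x \<in> U" if "x \<in> carrier G" for x
      using p.hom_closed[OF that] unfolding directed_union.hyps(4) by (rule UnionE) blast
    then show "carrier G = \<Union> (M ` \<F>)" unfolding M_def by blast
  qed
qed

theorem proposition4p4:
  fixes A :: "'a monoid" and G :: "'b monoid" and H :: "'c monoid"
    and i :: "'a \<Rightarrow> 'b" and p :: "'b \<Rightarrow> 'c"
  assumes "group A" and "group G" and "group H"
    and "i \<in> mon A G" and "p \<in> epi G H"
    and "i ` carrier A = kernel G H p"
    and "cyclic_group A"
    and "class_K H"
  shows "class_K G"
proof -
  interpret group_hom G H p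
    using assms(2,3,5) by (simp add: group_hom_def group_hom_axioms_def epi_def)
  have "i \<in> epi A (G\<lparr>carrier := kernel G H p\<rparr>)"
    unfolding epi_iff_subset
  proof (intro conjI homI)
    have "i \<in> hom A G" using assms(4) by (simp add: mon_def)
    from Group.hom_mult[OF this] show "i (x \<otimes>\<^bsub>A\<^esub> y) = i x \<otimes>\<^bsub>G\<lparr>carrier := kernel G H p\<rparr>\<^esub> i y"
      if "x \<in> carrier A" "y \<in> carrier A" for x y
      using that by simp
  qed (simp_all flip: assms(6))
  then have "cyclic_group (G\<lparr>carrier := kernel G H p\<rparr>)"
    by (rule group.cyclic_group_epimorphic_image[OF assms(1) _ assms(7)
          G.subgroup_imp_group[OF subgroup_kernel]])
  then show ?thesis by (rule class_K_cyclic_kernel[OF assms(8,2,5)])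
qed

end
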